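(* Let $\theta:\mathbb{R}^m\to(-\infty,\infty]$ be convex piecewise linear, let $\Phi:\mathbb{R}^n\times\mathbb{R}^d\to\mathbb{R}^m$ be $\mathcal{C}^2$-smooth around $(\bar x,\bar w)$, let $f:\mathbb{R}^n\times\mathbb{R}^d\to\mathbb{R}^n$, and let $$S(w):=\{x\in\mathbb{R}^n:\ 0\in f(x,w)+\partial_x(\theta\circ\Phi)(x,w)\},\qquad w\in\mathbb{R}^d.$$ Let $(\bar w,\bar x)\in\operatorname{gph}S$, let $f$ be strictly differentiable at $(\bar x,\bar w)$, and put $\bar v:=-f(\bar x,\bar w)\in\partial_x(\theta\circ\Phi)(\bar x,\bar w)$ and $\bar z:=\Phi(\bar x,\bar w)\in\operatorname{dom}\theta$. Assume that the nondegeneracy condition ND holds at $(\bar x,\bar w)$, let $\bar y\in\partial\theta(\bar z)$ be such that $\nabla_x\Phi(\bar x,\bar w)^*\bar y=\bar v$, and assume that for $u\in\mathbb{R}^n$ the following implication holds: $$\Big[0\in\nabla f(\bar x,\bar w)^*u+\big(\nabla^2_{xx}\langle\bar y,\Phi\rangle(\bar x,\bar w)u,\nabla^2_{xw}\langle\bar y,\Phi\rangle(\bar x,\bar w)u\big)+\big(\nabla_x\Phi(\bar x,\bar w),\nabla_w\Phi(\bar x,\bar w)\big)^*\partial^2\theta(\bar z,\bar y)(\nabla_x\Phi(\bar x,\bar w)u)\Big]\Longrightarrow u=0.$$ Then $S$ is Lipschitz-like around $(\bar w,\bar x)$ if $a=0$ is the only vector $a\in\mathbb{R}^d$ for which there is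 some $u\in\mathbb{R}^n$ with $\nabla_x\Phi(\bar x,\bar w)u\in\operatorname{dom}\partial^2\theta(\bar z,\bar y)$ and $$\big(-\nabla_xf(\bar x,\bar w)^*u,\ a-\nabla_wf(\bar x,\bar w)^*u\big)\in\big(\nabla^2_{xx}\langle\bar y,\Phi\rangle(\bar x,\bar w)u,\nabla^2_{xw}\langle\bar y,\Phi\rangle(\bar x,\bar w)u\big)+\big(\nabla_x\Phi(\bar x,\bar w),\nabla_w\Phi(\bar x,\bar w)\big)^*\partial^2\theta(\bar z,\bar y)(\nabla_x\Phi(\bar x,\bar w)u).$$
   Context: **Convex piecewise linear.** $\theta$ is convex piecewise linear if, for some $a_i\in\mathbb{R}^m,\alpha_i\in\mathbb{R}$ ($i\in T_1=\{1,\dots,l\}$), $d_i\in\mathbb{R}^m,\beta_i\in\mathbb{R}$ ($i\in T_2=\{1,\dots,p\}$), $\operatorname{dom}\theta=\{z:\langle d_i,z\rangle\le\beta_i,\ i\in T_2\}\ne\emptyset$, $\theta(z)=\max_{i\in T_1}\{\langle a_i,z\rangle-\alpha_i\}$ on $\operatorname{dom}\theta$, and $\theta=\infty$ elsewhere. $\partial\theta$ is the subdifferential of convex analysis. **Standing assumption.** $0\in\operatorname{aff}\partial\theta(\bar z)$. **Normal cone, subdifferentials.** For a set $\Omega$ and $\bar p\in\Omega$, $N(\bar p;\Omega)$ is the limiting (Mordukhovich) normal cone: all limits $v=\lim v_k$ with $p_k\to\bar p$, $p_k\in\Omega$, $\limsup_{p\to p_k,\,p\in\Omega}\langle v_k,p-p_k\rangle/\|p-p_k\|\le0$.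 For $\varphi:\mathbb{R}^n\to(-\infty,\infty]$, $\partial\varphi(x):=\{v:(v,-1)\in N((x,\varphi(x));\operatorname{epi}\varphi)\}$; $\partial_x(\theta\circ\Phi)(x,w)$ is the subdifferential at $x$ of $\theta(\Phi(\cdot,w))$. The second-order subdifferential is $\partial^2\theta(\bar z,\bar y)(u):=\{q:(q,-u)\in N((\bar z,\bar y);\operatorname{gph}\partial\theta)\}$, and $\operatorname{dom}\partial^2\theta(\bar z,\bar y):=\{u:\partial^2\theta(\bar z,\bar y)(u)\neq\emptyset\}$. **Explicit formula for $\partial^2\theta$ (known).** With $K(z):=\{i\in T_1:\langle a_i,z\rangle-\alpha_i=\max_j(\langle a_j,z\rangle-\alpha_j)\}$, $I(z):=\{i\in T_2:\langle d_i,z\rangle=\beta_i\}$, one has $q\in\partial^2\theta(\bar z,\bar y)(u)$ iff there are $P_1\subset Q_1\subset K(\bar z)$, $P_2\subset Q_2\subset I(\bar z)$ with $\bar y\in\operatorname{conv}\{a_i:i\in P_1\}+\operatorname{cone}\{d_i:i\in P_2\}$ and some $z\in\operatorname{dom}\theta$ with $K(z)=Q_1$, $I(z)=Q_2$, such that $q\in\operatorname{span}\{a_i-a_j:i,j\in P_1\}+\operatorname{cone}\{a_i-a_j:(i,j)\in(Q_1\setminus P_1)\times P_1\}+\operatorname{span}\{d_i:i\in P_2\}+\operatorname{cone}\{d_i:i\in Q_2\setminus P_2\}$ and $-u$ satisfies $\langle a_i-a_j,-u\rangle=0$ for $i,j\in P_1$, $\langle a_i-a_j,-u\rangle\le0$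 for $(i,j)\in(Q_1\setminus P_1)\times P_1$, $\langle d_i,-u\rangle=0$ for $i\in P_2$, $\langle d_i,-u\rangle\le0$ for $i\in Q_2\setminus P_2$. **Nondegeneracy condition ND** at $(\bar x,\bar w)$: $S(\bar z)\cap\ker\nabla_x\Phi(\bar x,\bar w)^*=\{0\}$ (equivalently $\nabla_x\Phi(\bar x,\bar w)\mathbb{R}^n+S(\bar z)^\perp=\mathbb{R}^m$), where $S(\bar z)$ is the linear subspace of $\mathbb{R}^m$ parallel to $\operatorname{aff}\partial\theta(\bar z)$ (not to be confused with the solution map $S$). **Derivative notation.** $\langle\bar y,\Phi\rangle(x,w):=\langle\bar y,\Phi(x,w)\rangle$; $\nabla^2_{xx}\langle\bar y,\Phi\rangle(\bar x,\bar w)u\in\mathbb{R}^n$ and $\nabla^2_{xw}\langle\bar y,\Phi\rangle(\bar x,\bar w)u\in\mathbb{R}^d$ are the partial gradients at $(\bar x,\bar w)$ with respect to $x$ and $w$ of $(x,w)\mapsto\langle\nabla_x\langle\bar y,\Phi\rangle(x,w),u\rangle$. Also $(\nabla_x\Phi,\nabla_w\Phi)^*q=(\nabla_x\Phi^*q,\nabla_w\Phi^*q)$ and $\nabla f^*u=(\nabla_xf^*u,\nabla_wf^*u)$, elements of $\mathbb{R}^n\times\mathbb{R}^d$. **Lipschitz-like (Aubin) property.** $S$ is Lipschitz-like around $(\bar w,\bar x)\in\operatorname{gph}S$ if there are neighborhoods $U$ of $\bar w$, $O$ of $\bar x$ and $\ell>0$ with $S(w_1)\cap O\subset S(w_2)+\ell\|w_1-w_2\|\mathbb{B}$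 for all $w_1,w_2\in U$, where $\mathbb{B}$ is the closed unit ball. *)

theory Defs
  imports "HOL-Analysis.Analysis"
begin

section \<open>Set-valued maps\<close>

definition gph :: "('a \<Rightarrow> 'b set) \<Rightarrow> ('a \<times> 'b) set" where
  "gph F = {(x, y). y \<in> F x}"

definition lipschitz_like ::
    "('w::real_normed_vector \<Rightarrow> 'x::real_normed_vector set) \<Rightarrow> 'w \<Rightarrow> 'x \<Rightarrow> bool" where
  "lipschitz_like S w x \<longleftrightarrow>
     (\<exists>U V L. open U \<and> w \<in> U \<and> open V \<and> x \<in> V \<and> (0::real) < L \<and>
        (\<forall>w1\<in>U. \<forall>w2\<in>U.
           S w1 \<inter> V \<subseteq> {x' + (L * norm (w1 - w2)) *\<^sub>R b |x' b. x' \<in> S w2 \<and> b \<in> cball 0 1}))"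

section \<open>Normal cones and subdifferentials\<close>

text \<open>At an isolated point of \<open>\<Omega>\<close> the filter below is trivial, the upper limit is
  \<open>-\<infinity>\<close>, and every vector is a regular normal.\<close>

definition regular_normal_cone :: "'a::real_inner \<Rightarrow> 'a set \<Rightarrow> 'a set" where
  "regular_normal_cone p \<Omega> =
     {v. Limsup (at p within \<Omega>) (\<lambda>p'. ereal (v \<bullet> (p' - p) / norm (p' - p))) \<le> 0}"

definition limiting_normal_cone :: "'a::real_inner \<Rightarrow> 'a set \<Rightarrow> 'a set" where
  "limiting_normal_cone p \<Omega> =
     {v. p \<in> \<Omega> \<and>
         (\<exists>(P :: nat \<Rightarrow> 'a) (V :: nat \<Rightarrow> 'a).
            (\<forall>k. P k \<in> \<Omega> \<and> V k \<in> regular_normal_cone (P k) \<Omega>) \<and>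
            P \<longlonglongrightarrow> p \<and> V \<longlonglongrightarrow> v)}"

definition effective_domain :: "('a \<Rightarrow> ereal) \<Rightarrow> 'a set" where
  "effective_domain \<phi> = {x. \<phi> x < \<infinity>}"

definition epigraph_ereal :: "('a \<Rightarrow> ereal) \<Rightarrow> ('a \<times> real) set" where
  "epigraph_ereal \<phi> = {(x, r). \<phi> x \<le> ereal r}"

text \<open>Both subdifferentials are empty at points where the function is not finite.\<close>

definition limiting_subdifferential :: "('a::real_inner \<Rightarrow> ereal) \<Rightarrow> 'a \<Rightarrow> 'a set" where
  "limiting_subdifferential \<phi> x =
     {v. \<exists>r. \<phi> x = ereal r \<and> (v, -1) \<in> limiting_normal_cone (x, r) (epigraph_ereal \<phi>)}"

definition convex_subdifferential :: "('a::real_inner \<Rightarrow> ereal) \<Rightarrow> 'a \<Rightarrow> 'a set" where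
  "convex_subdifferential \<theta> z =
     {y. \<exists>r. \<theta> z = ereal r \<and> (\<forall>z'. ereal (r + y \<bullet> (z' - z)) \<le> \<theta> z')}"

definition second_order_subdifferential ::
    "('a::real_inner \<Rightarrow> ereal) \<Rightarrow> 'a \<Rightarrow> 'a \<Rightarrow> 'a \<Rightarrow> 'a set" where
  "second_order_subdifferential \<theta> z y u =
     {q. (q, -u) \<in> limiting_normal_cone (z, y) (gph (convex_subdifferential \<theta>))}"

definition dom_second_order_subdifferential ::
    "('a::real_inner \<Rightarrow> ereal) \<Rightarrow> 'a \<Rightarrow> 'a \<Rightarrow> 'a set" where
  "dom_second_order_subdifferential \<theta> z y = {u. second_order_subdifferential \<theta> z y u \<noteq> {}}"

section \<open>Convex piecewise linear functions\<close>

text \<open>The number \<open>l\<close> of affine pieces is positive, so the maximum exists; \<open>p = 0\<close> (no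
  constraints) is allowed and is the same as the single constraint \<open>0 \<bullet> z \<le> 0\<close>.\<close>

definition convex_piecewise_linear :: "('a::real_inner \<Rightarrow> ereal) \<Rightarrow> bool" where
  "convex_piecewise_linear \<theta> \<longleftrightarrow>
     (\<exists>(l::nat) (p::nat) (a :: nat \<Rightarrow> 'a) (\<alpha> :: nat \<Rightarrow> real) (d :: nat \<Rightarrow> 'a) (\<beta> :: nat \<Rightarrow> real).
        1 \<le> l \<and>
        effective_domain \<theta> = {z. \<forall>i\<in>{1..p}. d i \<bullet> z \<le> \<beta> i} \<and>
        effective_domain \<theta> \<noteq> {} \<and>
        (\<forall>z\<in>effective_domain \<theta>. \<theta> z = ereal (Max ((\<lambda>i. a i \<bullet> z - \<alpha> i) ` {1..l}))) \<and>
        (\<forall>z. z \<notin> effective_domain \<theta> \<longrightarrow> \<theta> z = \<infinity>))"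

text \<open>The linear subspace parallel to the affine hull of the subdifferential; it exists and is
  unique when the subdifferential is nonempty (lemma \<open>affine_parallel_subspace\<close>).\<close>

definition parallel_subspace_subdifferential :: "('a::real_inner \<Rightarrow> ereal) \<Rightarrow> 'a \<Rightarrow> 'a set" where
  "parallel_subspace_subdifferential \<theta> z =
     (THE L. subspace L \<and> affine_parallel (affine hull (convex_subdifferential \<theta> z)) L)"

section \<open>Smoothness and partial derivatives\<close>

definition C2_around :: "('a::real_normed_vector \<Rightarrow> 'b::real_normed_vector) \<Rightarrow> 'a \<Rightarrow> bool" where
  "C2_around F p \<longleftrightarrow>
     (\<exists>U (F' :: 'a \<Rightarrow> 'a \<Rightarrow>\<^sub>L 'b) (F'' :: 'a \<Rightarrow> 'a \<Rightarrow>\<^sub>L 'a \<Rightarrow>\<^sub>L 'b).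
        open U \<and> p \<in> U \<and>
        (\<forall>x\<in>U. (F has_derivative blinfun_apply (F' x)) (at x)) \<and>
        (\<forall>x\<in>U. (F' has_derivative blinfun_apply (F'' x)) (at x)) \<and>
        continuous_on U F'')"

definition strictly_differentiable_at ::
    "('a::real_normed_vector \<Rightarrow> 'b::real_normed_vector) \<Rightarrow> 'a \<Rightarrow> bool" where
  "strictly_differentiable_at f p \<longleftrightarrow>
     (\<exists>A. bounded_linear A \<and>
        (\<forall>\<epsilon>>0. \<exists>\<delta>>0. \<forall>p1\<in>ball p \<delta>. \<forall>p2\<in>ball p \<delta>.
           norm (f p1 - f p2 - A (p1 - p2)) \<le> \<epsilon> * norm (p1 - p2)))"

definition deriv_x ::
    "('x::real_normed_vector \<times> 'w \<Rightarrow> 'b::real_normed_vector) \<Rightarrow> 'x \<Rightarrow> 'w \<Rightarrow> 'x \<Rightarrow> 'b" where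
  "deriv_x F x w = frechet_derivative (\<lambda>x'. F (x', w)) (at x)"

definition deriv_w ::
    "('x \<times> 'w::real_normed_vector \<Rightarrow> 'b::real_normed_vector) \<Rightarrow> 'x \<Rightarrow> 'w \<Rightarrow> 'w \<Rightarrow> 'b" where
  "deriv_w F x w = frechet_derivative (\<lambda>w'. F (x, w')) (at w)"

text \<open>The adjoint of the total derivative, given by its two partial blocks.\<close>

definition adjoint_deriv ::
    "('x::real_inner \<times> 'w::real_inner \<Rightarrow> 'b::real_inner) \<Rightarrow> 'x \<Rightarrow> 'w \<Rightarrow> 'b \<Rightarrow> 'x \<times> 'w" where
  "adjoint_deriv F x w q = (adjoint (deriv_x F x w) q, adjoint (deriv_w F x w) q)"

definition gradient :: "('a::real_inner \<Rightarrow> real) \<Rightarrow> 'a \<Rightarrow> 'a" where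
  "gradient \<phi> x = (THE g. GDERIV \<phi> x :> g)"

text \<open>\<open>hess_xx \<phi> x w u\<close> and \<open>hess_xw \<phi> x w u\<close> are the partial gradients in \<open>x\<close> and in \<open>w\<close> of
  the map sending \<open>(x, w)\<close> to \<open>\<langle>\<nabla>\<^sub>x\<phi>(x, w), u\<rangle>\<close>.\<close>

definition hess_xx ::
    "('x::real_inner \<times> 'w::real_inner \<Rightarrow> real) \<Rightarrow> 'x \<Rightarrow> 'w \<Rightarrow> 'x \<Rightarrow> 'x" where
  "hess_xx \<phi> x w u = gradient (\<lambda>x'. gradient (\<lambda>\<xi>. \<phi> (\<xi>, w)) x' \<bullet> u) x"

definition hess_xw ::
    "('x::real_inner \<times> 'w::real_inner \<Rightarrow> real) \<Rightarrow> 'x \<Rightarrow> 'w \<Rightarrow> 'x \<Rightarrow> 'w" where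
  "hess_xw \<phi> x w u = gradient (\<lambda>w'. gradient (\<lambda>\<xi>. \<phi> (\<xi>, w')) x \<bullet> u) w"

section \<open>The parametric system\<close>

definition solution_map ::
    "('x::real_inner \<times> 'w \<Rightarrow> 'x) \<Rightarrow> ('z \<Rightarrow> ereal) \<Rightarrow> ('x \<times> 'w \<Rightarrow> 'z) \<Rightarrow> 'w \<Rightarrow> 'x set" where
  "solution_map f \<theta> \<Phi> w =
     {x. 0 \<in> (\<lambda>v. f (x, w) + v) ` limiting_subdifferential (\<lambda>x'. \<theta> (\<Phi> (x', w))) x}"

definition nondegenerate ::
    "('z::real_inner \<Rightarrow> ereal) \<Rightarrow> ('x::real_inner \<times> 'w \<Rightarrow> 'z) \<Rightarrow> 'x \<Rightarrow> 'w \<Rightarrow> bool" where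
  "nondegenerate \<theta> \<Phi> x w \<longleftrightarrow>
     parallel_subspace_subdifferential \<theta> (\<Phi> (x, w)) \<inter> {q. adjoint (deriv_x \<Phi> x w) q = 0} = {0}"

text \<open>The set \<open>(\<nabla>\<^sup>2\<^sub>x\<^sub>x\<langle>y,\<Phi>\<rangle>u, \<nabla>\<^sup>2\<^sub>x\<^sub>w\<langle>y,\<Phi>\<rangle>u) + (\<nabla>\<^sub>x\<Phi>, \<nabla>\<^sub>w\<Phi>)\<^sup>*\<partial>\<^sup>2\<theta>(z, y)(\<nabla>\<^sub>x\<Phi> u)\<close> with \<open>z = \<Phi>(x, w)\<close>.\<close>

definition second_order_set ::
    "('z::real_inner \<Rightarrow> ereal) \<Rightarrow> ('x::real_inner \<times> 'w::real_inner \<Rightarrow> 'z) \<Rightarrow>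
     'x \<Rightarrow> 'w \<Rightarrow> 'z \<Rightarrow> 'x \<Rightarrow> ('x \<times> 'w) set" where
  "second_order_set \<theta> \<Phi> x w y u =
     (\<lambda>q. (hess_xx (\<lambda>p. y \<bullet> \<Phi> p) x w u, hess_xw (\<lambda>p. y \<bullet> \<Phi> p) x w u) + adjoint_deriv \<Phi> x w q) `
       second_order_subdifferential \<theta> (\<Phi> (x, w)) y (deriv_x \<Phi> x w u)"

end

theory Submission
  imports Defs
begin

text \<open>For \<open>(x, w)\<close> near the reference point, \<open>x \<in> S(w)\<close> holds iff some \<open>y\<close> solves the system
  \<open>f(x, w) + \<nabla>\<^sub>x\<Phi>(x, w)\<^sup>* y = 0\<close>, \<open>(\<Phi>(x, w), y) \<in> gph \<partial>\<theta>\<close>. By nondegeneracy \<open>y\<close> is unique and tends to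
  the reference multiplier. The system has the form \<open>H((x, y), w) \<in> C\<close> with \<open>H\<close> strictly
  differentiable and \<open>C = {0} \<times> gph \<partial>\<theta>\<close> closed. Its solution map has the Aubin property if no nonzero
  limiting normal of \<open>C\<close> is annihilated by the adjoint of the partial derivative of \<open>H\<close> in
  \<open>(x, y)\<close>. For such a normal the two hypotheses give \<open>a = 0\<close> and then \<open>u = 0\<close>, and nondegeneracy
  kills the remaining component \<open>q\<close> because normals to \<open>gph \<partial>\<theta>\<close> have their first component in
  the subspace parallel to \<open>aff \<partial>\<theta>(z)\<close>.

  The only polyhedral fact needed is that near \<open>z\<close> the function \<open>\<theta>\<close> is affine, with slope \<open>y\<close>, along
  the orthogonal complement of that subspace.\<close>

section \<open>Regular and limiting normals\<close>

text \<open>Treating the multiplier as an unknown keeps the constraint set constant: all dependence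
  on \<open>w\<close> sits in a strictly differentiable map, whereas the subdifferential of the
  composition moves with \<open>w\<close>. The price is the return trip: a solution near the
  reference point must come with a multiplier near \<open>y\<close>. This rests on a lower bound for
  the adjoint on the parallel subspace that is uniform near the reference point. Away from that
  point \<open>f\<close> need not be differentiable, so the regularity estimate may use only the
  derivative at the reference point and the normals of the constraint set at nearby points. The same
  implicit theorem also serves in the chain rule; there the constraint set is a subspace and
  nondegeneracy is the qualification. The vanishing adjoint in \<open>(x, y)\<close> says nothing
  about the \<open>w\<close>-component of the normal equation. That component is therefore named
  \<open>a\<close>; only after it is known to vanish does the implication for \<open>u\<close>
  apply.\<close>

lemma regular_normal_cone_iff:
  "v \<in> regular_normal_cone p \<Omega> \<longleftrightarrow>
     (\<forall>e>0. \<forall>\<^sub>F q in at p within \<Omega>. v \<bullet> (q - p) \<le> e * norm (q - p))"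
proof
  assume v: "v \<in> regular_normal_cone p \<Omega>"
  show "\<forall>e>0. \<forall>\<^sub>F q in at p within \<Omega>. v \<bullet> (q - p) \<le> e * norm (q - p)"
  proof (intro allI impI)
    fix e :: real assume "0 < e"
    then have "\<forall>\<^sub>F q in at p within \<Omega>. ereal (v \<bullet> (q - p) / norm (q - p)) < ereal e"
      using v unfolding regular_normal_cone_def mem_Collect_eq Limsup_le_iff by (metis ereal_less(2))
    moreover have "\<forall>\<^sub>F q in at p within \<Omega>. q \<noteq> p"
      by (simp add: eventually_at_filter)
    ultimately show "\<forall>\<^sub>F q in at p within \<Omega>. v \<bullet> (q - p) \<le> e * norm (q - p)"
      by eventually_elim (simp add: divide_less_eq)
  qed
next
  assume v: "\<forall>e>0. \<forall>\<^sub>F q in at p within \<Omega>. v \<bullet> (q - p) \<le> e * norm (q - p)"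
  have "\<forall>\<^sub>F q in at p within \<Omega>. ereal (v \<bullet> (q - p) / norm (q - p)) < y" if "0 < y" for y
  proof -
    obtain e where e: "0 < ereal e" "ereal e < y"
      using ereal_dense2[OF \<open>0 < y\<close>] by (auto simp: zero_ereal_def)
    have "\<forall>\<^sub>F q in at p within \<Omega>. v \<bullet> (q - p) \<le> e * norm (q - p)"
      using v e by simp
    moreover have "\<forall>\<^sub>F q in at p within \<Omega>. q \<noteq> p"
      by (simp add: eventually_at_filter)
    ultimately show ?thesis
    proof eventually_elim
      case (elim q)
      then have "v \<bullet> (q - p) / norm (q - p) \<le> e"
        by (simp add: divide_le_eq)
      with e(2) show ?case
        by (metis ereal_less_eq(3) order_le_less_trans)
    qed
  qed
  then show "v \<in> regular_normal_cone p \<Omega>"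
    by (simp add: regular_normal_cone_def Limsup_le_iff)
qed

lemma regular_normal_coneD:
  assumes "v \<in> regular_normal_cone p \<Omega>" "0 < e"
  obtains d where "0 < d" "\<And>q. q \<in> \<Omega> \<Longrightarrow> dist q p < d \<Longrightarrow> v \<bullet> (q - p) \<le> e * norm (q - p)"
proof -
  have "\<forall>\<^sub>F q in at p within \<Omega>. v \<bullet> (q - p) \<le> e * norm (q - p)"
    using assms by (auto simp: regular_normal_cone_iff)
  then obtain d where "0 < d" and
    d: "\<forall>q\<in>\<Omega>. q \<noteq> p \<and> dist q p < d \<longrightarrow> v \<bullet> (q - p) \<le> e * norm (q - p)"
    by (auto simp: eventually_at)
  moreover have "v \<bullet> (q - p) \<le> e * norm (q - p)" if "q \<in> \<Omega>" "dist q p < d" for q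
    using d that by (cases "q = p") auto
  ultimately show thesis using that by blast
qed

lemma regular_normal_coneI:
  assumes "\<And>e. 0 < e \<Longrightarrow>
    \<exists>d>0. \<forall>q\<in>\<Omega>. dist q p < d \<longrightarrow> v \<bullet> (q - p) \<le> e * norm (q - p)"
  shows "v \<in> regular_normal_cone p \<Omega>"
  unfolding regular_normal_cone_iff eventually_at using assms by blast

text \<open>Along the segment both sides of the defining inequality are linear in \<open>t\<close>,
  so \<open>t\<close> cancels and the error is arbitrary. Used for \<open>s\<close> and
  \<open>-s\<close>, this makes normals orthogonal to directions in which the set is locally
  invariant.\<close>

lemma regular_normal_cone_direction:
  assumes v: "v \<in> regular_normal_cone p \<Omega>" and "0 < d"
    and ray: "\<And>t. 0 < t \<Longrightarrow> t < d \<Longrightarrow> p + t *\<^sub>R s \<in> \<Omega>"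
  shows "v \<bullet> s \<le> 0"
proof (rule field_le_epsilon)
  fix e :: real assume "0 < e"
  \<comment> \<open>The \<open>+ 1\<close> covers \<open>s = 0\<close>, here and in
    \<open>t\<close>.\<close>
  define e' where "e' = e / (norm s + 1)"
  have "0 < e'" using \<open>0 < e\<close> by (simp add: e'_def add_nonneg_pos)
  then obtain r where r: "0 < r"
      "\<And>q. q \<in> \<Omega> \<Longrightarrow> dist q p < r \<Longrightarrow> v \<bullet> (q - p) \<le> e' * norm (q - p)"
    using regular_normal_coneD[OF v] by blast
  define t where "t = min (d / 2) (r / (norm s + 1) / 2)"
  have t: "0 < t" "t < d" using \<open>0 < d\<close> \<open>0 < r\<close> by (auto simp: t_def add_nonneg_pos)
  have "t * (norm s + 1) < r"
  proof -
    have "t \<le> r / (norm s + 1) / 2" by (simp add: t_def)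
    then have "t * (norm s + 1) \<le> r / 2"
      using add_nonneg_pos[OF norm_ge_zero[of s] zero_less_one] by (simp add: field_simps)
    then show ?thesis using \<open>0 < r\<close> by simp
  qed
  then have "t * norm s < r" using t by (simp add: algebra_simps)
  then have "v \<bullet> (t *\<^sub>R s) \<le> e' * norm (t *\<^sub>R s)"
    using r(2)[OF ray[OF t]] t by (simp add: dist_norm)
  then have "v \<bullet> s \<le> e' * norm s"
    using t by (simp add: mult.left_commute)
  also have "\<dots> \<le> e"
    using \<open>0 < e\<close> by (simp add: e'_def divide_le_eq add_nonneg_pos mult_left_mono)
  finally show "v \<bullet> s \<le> 0 + e" by simp
qed

lemma regular_normal_cone_scaleR:
  assumes v: "v \<in> regular_normal_cone p \<Omega>" and "0 \<le> t"
  shows "t *\<^sub>R v \<in> regular_normal_cone p \<Omega>"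
proof (rule regular_normal_coneI)
  fix e :: real assume "0 < e"
  then have "0 < e / (t + 1)" using \<open>0 \<le> t\<close> by simp
  then obtain d where d: "0 < d"
      "\<And>q. q \<in> \<Omega> \<Longrightarrow> dist q p < d \<Longrightarrow> v \<bullet> (q - p) \<le> e / (t + 1) * norm (q - p)"
    using regular_normal_coneD[OF v] by blast
  have "t *\<^sub>R v \<bullet> (q - p) \<le> e * norm (q - p)" if "q \<in> \<Omega>" "dist q p < d" for q
  proof -
    have "t *\<^sub>R v \<bullet> (q - p) \<le> t * (e / (t + 1) * norm (q - p))"
      using mult_left_mono[OF d(2)[OF that] \<open>0 \<le> t\<close>] by simp
    also have "\<dots> = (t / (t + 1)) * (e * norm (q - p))" by simp
    also have "\<dots> \<le> 1 * (e * norm (q - p))"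
      using \<open>0 \<le> t\<close> \<open>0 < e\<close> by (intro mult_right_mono) auto
    finally show ?thesis by simp
  qed
  then show "\<exists>d>0. \<forall>q\<in>\<Omega>. dist q p < d \<longrightarrow> t *\<^sub>R v \<bullet> (q - p) \<le> e * norm (q - p)"
    using d(1) by blast
qed

text \<open>Expanding |h - q|^2 >= |h - c|^2 leaves 2 (h - c) . (q - c) <= |q - c|^2. The right side
  is of second order, so \<open>e\<close> itself works as the radius.\<close>

lemma nearest_point_regular_normal:
  fixes C :: "'a::real_inner set"
  assumes near: "\<And>c'. c' \<in> C \<Longrightarrow> dist h c \<le> dist h c'"
  shows "h - c \<in> regular_normal_cone c C"
proof (rule regular_normal_coneI)
  fix e :: real assume "0 < e"
  have "(h - c) \<bullet> (q - c) \<le> e * norm (q - c)" if "q \<in> C" "dist q c < e" for q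
  proof -
    have "(norm (h - c))\<^sup>2 \<le> (norm (h - q))\<^sup>2"
      using near[OF \<open>q \<in> C\<close>] by (simp add: dist_norm)
    also have "h - q = (h - c) - (q - c)" by simp
    also have "(norm \<dots>)\<^sup>2 = (norm (h - c))\<^sup>2 - 2 * ((h - c) \<bullet> (q - c)) + (norm (q - c))\<^sup>2"
      by (simp only: power2_norm_eq_inner) (simp add: inner_diff_left inner_diff_right inner_commute)
    finally have "2 * ((h - c) \<bullet> (q - c)) \<le> norm (q - c) * norm (q - c)"
      by (simp add: power2_eq_square)
    also have "\<dots> \<le> e * norm (q - c)"
      using \<open>dist q c < e\<close> by (intro mult_right_mono) (auto simp: dist_norm)
    finally show ?thesis
      using mult_nonneg_nonneg[OF less_imp_le[OF \<open>0 < e\<close>] norm_ge_zero[of "q - c"]] by linarith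
  qed
  then show "\<exists>d>0. \<forall>q\<in>C. dist q c < d \<longrightarrow> (h - c) \<bullet> (q - c) \<le> e * norm (q - c)"
    using \<open>0 < e\<close> by blast
qed

lemma limiting_normal_coneI:
  assumes "p \<in> \<Omega>" "\<And>k. P k \<in> \<Omega>" "\<And>k. V k \<in> regular_normal_cone (P k) \<Omega>"
    "P \<longlonglongrightarrow> p" "V \<longlonglongrightarrow> v"
  shows "v \<in> limiting_normal_cone p \<Omega>"
  unfolding limiting_normal_cone_def using assms by blast

lemma limiting_normal_coneE:
  assumes "v \<in> limiting_normal_cone p \<Omega>"
  obtains P V where "p \<in> \<Omega>" "\<And>k. P k \<in> \<Omega>" "\<And>k. V k \<in> regular_normal_cone (P k) \<Omega>"
    "P \<longlonglongrightarrow> p" "V \<longlonglongrightarrow> v"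
  using assms unfolding limiting_normal_cone_def by blast

text \<open>If no constants work, there are unit regular normals at points tending to
  \<open>h\<close> whose images under \<open>B\<close> tend to 0; by compactness of the sphere a
  subsequence tends to a unit limiting normal in the kernel of \<open>B\<close>. A condition at one
  point thus becomes an estimate at all nearby points of \<open>C\<close>.\<close>

lemma limiting_normal_cone_modulus:
  fixes C :: "'a::euclidean_space set" and B :: "'a \<Rightarrow> 'b::real_normed_vector"
  assumes "closed C" and B: "bounded_linear B"
    and inj: "\<And>l. l \<in> limiting_normal_cone h C \<Longrightarrow> B l = 0 \<Longrightarrow> l = 0"
  obtains \<kappa> \<rho> where "0 < \<kappa>" "0 < \<rho>"
    "\<And>c l. c \<in> C \<Longrightarrow> dist c h < \<rho> \<Longrightarrow> l \<in> regular_normal_cone c C \<Longrightarrow> \<kappa> * norm l \<le> norm (B l)"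
proof -
  interpret B: bounded_linear B by fact
  \<comment> \<open>One number serves as radius and as modulus, so that negating the claim at
    1/(n+1) yields a single sequence.\<close>
  have "\<exists>\<kappa>>0. \<forall>c\<in>C. dist c h < \<kappa> \<longrightarrow> (\<forall>l\<in>regular_normal_cone c C. \<kappa> * norm l \<le> norm (B l))"
  proof (rule ccontr)
    assume contra: "\<not> ?thesis"
    have "\<exists>c l. c \<in> C \<and> dist c h < 1 / real (Suc n) \<and> l \<in> regular_normal_cone c C
        \<and> norm l = 1 \<and> norm (B l) < 1 / real (Suc n)" for n
    proof -
      obtain c l where cl: "c \<in> C" "dist c h < 1 / real (Suc n)" "l \<in> regular_normal_cone c C"
          "norm (B l) < 1 / real (Suc n) * norm l"
        using contra by (metis zero_less_divide_1_iff not_le of_nat_0_less_iff zero_less_Suc)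
      have "l \<noteq> 0" using cl(4) by auto
      have "inverse (norm l) *\<^sub>R l \<in> regular_normal_cone c C"
        using cl(3) by (rule regular_normal_cone_scaleR) simp
      moreover have "norm (B (inverse (norm l) *\<^sub>R l)) < 1 / real (Suc n)"
        using cl(4) \<open>l \<noteq> 0\<close> by (simp add: B.scaleR field_simps)
      ultimately show ?thesis using cl(1,2) \<open>l \<noteq> 0\<close>
        by (intro exI[of _ c] exI[of _ "inverse (norm l) *\<^sub>R l"]) auto
    qed
    then obtain c l where c: "\<And>n. c n \<in> C" "\<And>n. dist (c n) h < 1 / real (Suc n)"
        and l: "\<And>n. l n \<in> regular_normal_cone (c n) C" "\<And>n. norm (l n) = 1"
          "\<And>n. norm (B (l n)) < 1 / real (Suc n)"
      by metis
    have "\<forall>n. l n \<in> sphere 0 1" using l(2) by simp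
    then obtain l' r where l': "l' \<in> sphere 0 1" "strict_mono r" "(l \<circ> r) \<longlonglongrightarrow> l'"
      using compact_sphere[of "0::'a" 1] unfolding compact_def by blast
    have "(\<lambda>n. dist (c n) h) \<longlonglongrightarrow> 0"
      using c(2) by (intro LIMSEQ_norm_0) simp
    then have ch: "c \<longlonglongrightarrow> h" by (subst tendsto_dist_iff)
    then have crh: "(c \<circ> r) \<longlonglongrightarrow> h" using l'(2) LIMSEQ_subseq_LIMSEQ by blast
    have "h \<in> C" using \<open>closed C\<close> ch c(1) closed_sequentially by blast
    then have "l' \<in> limiting_normal_cone h C"
      using crh l'(3) c(1) l(1) by (intro limiting_normal_coneI[of h C "c \<circ> r" "l \<circ> r"]) auto
    moreover have "B l' = 0"
    proof -
      have "(\<lambda>n. B (l n)) \<longlonglongrightarrow> 0"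
        using l(3) by (intro LIMSEQ_norm_0)
      then have "(\<lambda>n. B (l (r n))) \<longlonglongrightarrow> 0"
        using l'(2) LIMSEQ_subseq_LIMSEQ[of "\<lambda>n. B (l n)" 0 r] by (simp add: o_def)
      moreover have "(\<lambda>n. B (l (r n))) \<longlonglongrightarrow> B l'"
        using B.tendsto[OF l'(3)] by (simp add: o_def)
      ultimately show ?thesis using LIMSEQ_unique by blast
    qed
    ultimately show False using inj l'(1) by force
  qed
  then show thesis using that by blast
qed

section \<open>Strict derivatives\<close>

text \<open>\<open>strictly_differentiable_at\<close> hides the derivative behind an existential;
  naming it allows chain, product and pairing rules.\<close>

definition has_strict_derivative ::
    "('a::real_normed_vector \<Rightarrow> 'b::real_normed_vector) \<Rightarrow> ('a \<Rightarrow> 'b) \<Rightarrow> 'a \<Rightarrow> bool" where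
  "has_strict_derivative f f' p \<longleftrightarrow> bounded_linear f' \<and>
     (\<forall>e>0. \<exists>d>0. \<forall>a\<in>ball p d. \<forall>b\<in>ball p d. norm (f a - f b - f' (a - b)) \<le> e * norm (a - b))"

lemma strictly_differentiable_at_iff:
  "strictly_differentiable_at f p \<longleftrightarrow> (\<exists>f'. has_strict_derivative f f' p)"
  by (simp add: strictly_differentiable_at_def has_strict_derivative_def)

lemma has_strict_derivative_bounded_linear:
  "has_strict_derivative f f' p \<Longrightarrow> bounded_linear f'"
  by (simp add: has_strict_derivative_def)

lemma has_strict_derivativeE:
  assumes "has_strict_derivative f f' p" "0 < e"
  obtains d where "0 < d"
    "\<And>a b. dist a p < d \<Longrightarrow> dist b p < d \<Longrightarrow> norm (f a - f b - f' (a - b)) \<le> e * norm (a - b)"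
proof -
  obtain d where "0 < d" and
    "\<forall>a\<in>ball p d. \<forall>b\<in>ball p d. norm (f a - f b - f' (a - b)) \<le> e * norm (a - b)"
    using assms unfolding has_strict_derivative_def by blast
  then show thesis using that[of d] by (auto simp: dist_commute)
qed

lemma has_strict_derivativeI:
  assumes "bounded_linear f'"
    and "\<And>e. 0 < e \<Longrightarrow> \<exists>d>0. \<forall>a b. dist a p < d \<longrightarrow> dist b p < d \<longrightarrow>
        norm (f a - f b - f' (a - b)) \<le> e * norm (a - b)"
  shows "has_strict_derivative f f' p"
  unfolding has_strict_derivative_def
proof (intro conjI allI impI)
  fix e :: real assume "0 < e"
  then obtain d where "0 < d" "\<forall>a b. dist a p < d \<longrightarrow> dist b p < d \<longrightarrow>
        norm (f a - f b - f' (a - b)) \<le> e * norm (a - b)" using assms(2) by blast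
  then show "\<exists>d>0. \<forall>a\<in>ball p d. \<forall>b\<in>ball p d. norm (f a - f b - f' (a - b)) \<le> e * norm (a - b)"
    by (intro exI[of _ d]) (auto simp: dist_commute)
qed (fact assms(1))

lemma has_strict_derivative_imp_has_derivative:
  assumes "has_strict_derivative f f' p"
  shows "(f has_derivative f') (at p)"
  unfolding has_derivative_at_alt
proof (intro conjI allI impI)
  fix e :: real assume "0 < e"
  then obtain d where "0 < d"
    "\<And>a b. dist a p < d \<Longrightarrow> dist b p < d \<Longrightarrow> norm (f a - f b - f' (a - b)) \<le> e * norm (a - b)"
    using has_strict_derivativeE[OF assms] by blast
  then show "\<exists>d>0. \<forall>y. norm (y - p) < d \<longrightarrow> norm (f y - f p - f' (y - p)) \<le> e * norm (y - p)"
    by (intro exI[of _ d]) (auto simp: dist_norm)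
qed (rule has_strict_derivative_bounded_linear[OF assms])

lemma has_strict_derivative_lipschitz:
  assumes f: "has_strict_derivative f f' p"
  obtains d M where "0 < d" "0 < M"
    "\<And>a b. dist a p < d \<Longrightarrow> dist b p < d \<Longrightarrow> norm (f a - f b) \<le> M * norm (a - b)"
proof -
  obtain K where K: "0 < K" "\<And>h. norm (f' h) \<le> norm h * K"
    using bounded_linear.pos_bounded[OF has_strict_derivative_bounded_linear[OF f]] by blast
  obtain d where d: "0 < d"
    "\<And>a b. dist a p < d \<Longrightarrow> dist b p < d \<Longrightarrow> norm (f a - f b - f' (a - b)) \<le> 1 * norm (a - b)"
    using has_strict_derivativeE[OF f, of 1] by auto
  have "norm (f a - f b) \<le> (1 + K) * norm (a - b)" if "dist a p < d" "dist b p < d" for a b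
  proof -
    have "norm (f a - f b) \<le> norm (f a - f b - f' (a - b)) + norm (f' (a - b))"
      using norm_triangle_ineq[of "f a - f b - f' (a - b)" "f' (a - b)"] by simp
    also have "\<dots> \<le> 1 * norm (a - b) + norm (a - b) * K"
      by (intro add_mono d(2) K(2) that)
    finally show ?thesis by (simp add: algebra_simps)
  qed
  then show thesis using that[of d "1 + K"] d(1) K(1) by simp
qed

text \<open>On a small ball the derivative of \<open>f\<close> minus the linear map
  \<open>f' p\<close> has norm at most \<open>e\<close>, and the ball is convex, so the mean value
  inequality applies to every pair of its points.\<close>

lemma C1_imp_has_strict_derivative:
  fixes f' :: "'a::real_normed_vector \<Rightarrow> 'a \<Rightarrow>\<^sub>L 'b::real_normed_vector"
  assumes "open U" "p \<in> U" and f: "\<And>x. x \<in> U \<Longrightarrow> (f has_derivative f' x) (at x)"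
    and cont: "continuous_on U f'"
  shows "has_strict_derivative f (f' p) p"
proof (rule has_strict_derivativeI)
  fix e :: real assume "0 < e"
  have "isCont f' p" using cont \<open>open U\<close> \<open>p \<in> U\<close> by (simp add: continuous_on_eq_continuous_at)
  then obtain d1 where d1: "0 < d1" "\<And>x. dist x p < d1 \<Longrightarrow> dist (f' x) (f' p) < e"
    using \<open>0 < e\<close> unfolding continuous_at_eps_delta by blast
  obtain d2 where d2: "0 < d2" "ball p d2 \<subseteq> U"
    using \<open>open U\<close> \<open>p \<in> U\<close> open_contains_ball by blast
  define d where "d = min d1 d2"
  have "norm (f a - f b - f' p (a - b)) \<le> e * norm (a - b)"
    if "dist a p < d" "dist b p < d" for a b
  proof -
    have "norm (f a - f b - f' p (a - b)) \<le> norm (a - b) * e"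
    proof (rule differentiable_bound_linearization[where S = "ball p d"])
      show "b + t *\<^sub>R (a - b) \<in> ball p d" if "t \<in> {0..1}" for t
      proof -
        have "b + t *\<^sub>R (a - b) \<in> closed_segment b a"
          using that by (auto simp: in_segment algebra_simps intro!: exI[of _ t])
        moreover have "closed_segment b a \<subseteq> ball p d"
          using \<open>dist a p < d\<close> \<open>dist b p < d\<close>
          by (intro closed_segment_subset) (auto simp: dist_commute)
        ultimately show ?thesis by blast
      qed
      show "(f has_derivative f' x) (at x within ball p d)" if "x \<in> ball p d" for x
      proof (rule has_derivative_at_withinI, rule f)
        show "x \<in> U" using that d2(2) by (auto simp: d_def)
      qed
      show "onorm (blinfun_apply (f' x) - blinfun_apply (f' p)) \<le> e" if "x \<in> ball p d" for x
      proof -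
        have "dist x p < d1" using that by (simp add: d_def dist_commute)
        then have "norm (f' x - f' p) \<le> e" using d1(2) by (simp add: dist_norm less_imp_le)
        then show ?thesis
          by (simp add: norm_blinfun.rep_eq fun_diff_def minus_blinfun.rep_eq)
      qed
      show "p \<in> ball p d" using d1(1) d2(1) by (simp add: d_def)
    qed
    then show ?thesis by (simp add: mult.commute)
  qed
  then show "\<exists>d>0. \<forall>a b. dist a p < d \<longrightarrow> dist b p < d \<longrightarrow>
      norm (f a - f b - f' p (a - b)) \<le> e * norm (a - b)"
    using d1(1) d2(1) by (intro exI[of _ d]) (auto simp: d_def)
qed (rule blinfun.bounded_linear_right)

lemma has_strict_derivative_linear:
  "bounded_linear f \<Longrightarrow> has_strict_derivative f f p"
  by (rule has_strict_derivativeI)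
     (auto simp: linear_diff bounded_linear.linear intro!: exI[of _ 1])

lemma has_strict_derivative_compose:
  assumes f: "has_strict_derivative f f' p" and g: "has_strict_derivative g g' (f p)"
  shows "has_strict_derivative (\<lambda>x. g (f x)) (\<lambda>h. g' (f' h)) p"
proof (rule has_strict_derivativeI)
  show "bounded_linear (\<lambda>h. g' (f' h))"
    using g f by (intro bounded_linear_compose[of g' f'] has_strict_derivative_bounded_linear)
  interpret g': bounded_linear g' using g by (rule has_strict_derivative_bounded_linear)
  fix e :: real assume "0 < e"
  obtain K where K: "0 < K" "\<And>h. norm (g' h) \<le> norm h * K"
    using g'.pos_bounded by blast
  obtain d1 M where M: "0 < d1" "0 < M"
    "\<And>a b. dist a p < d1 \<Longrightarrow> dist b p < d1 \<Longrightarrow> norm (f a - f b) \<le> M * norm (a - b)"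
    using has_strict_derivative_lipschitz[OF f] by blast
  \<comment> \<open>Half of the error for each source: that of \<open>f\<close> is amplified by
    \<open>g'\<close>, hence by at most \<open>K\<close>; that of \<open>g\<close> is measured
    against |f a - f b|, hence against \<open>M\<close> times |a - b|.\<close>
  have "0 < e / (2 * K)" "0 < e / (2 * M)" using \<open>0 < e\<close> K(1) M(2) by auto
  obtain d2 where d2: "0 < d2" "\<And>a b. dist a p < d2 \<Longrightarrow> dist b p < d2 \<Longrightarrow>
      norm (f a - f b - f' (a - b)) \<le> e / (2 * K) * norm (a - b)"
    using has_strict_derivativeE[OF f \<open>0 < e / (2 * K)\<close>] by blast
  obtain d3 where d3: "0 < d3" "\<And>a b. dist a (f p) < d3 \<Longrightarrow> dist b (f p) < d3 \<Longrightarrow>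
      norm (g a - g b - g' (a - b)) \<le> e / (2 * M) * norm (a - b)"
    using has_strict_derivativeE[OF g \<open>0 < e / (2 * M)\<close>] by blast
  define d where "d = min (min d1 d2) (d3 / M)"
  have "0 < d" using M(1,2) d2(1) d3(1) by (simp add: d_def)
  have near: "dist (f a) (f p) < d3" if "dist a p < d" for a
  proof -
    have "dist (f a) (f p) \<le> M * dist a p"
      using M(3)[of a p] that M(1) by (simp add: d_def dist_norm)
    also have "\<dots> < d3" using that M(2) by (simp add: d_def field_simps)
    finally show ?thesis .
  qed
  have "norm (g (f a) - g (f b) - g' (f' (a - b))) \<le> e * norm (a - b)"
    if ab: "dist a p < d" "dist b p < d" for a b
  proof -
    have "g (f a) - g (f b) - g' (f' (a - b)) =
        (g (f a) - g (f b) - g' (f a - f b)) + g' (f a - f b - f' (a - b))"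
      by (simp add: g'.diff)
    also have "norm \<dots> \<le> e / (2 * M) * norm (f a - f b) + norm (f a - f b - f' (a - b)) * K"
      by (intro norm_triangle_mono d3(2) near ab K(2))
    also have "\<dots> \<le> e / (2 * M) * (M * norm (a - b)) + e / (2 * K) * norm (a - b) * K"
      using ab \<open>0 < e\<close> M(2) K(1) by (intro add_mono mult_left_mono mult_right_mono M(3) d2(2)) (auto simp: d_def)
    also have "\<dots> = e * norm (a - b)" using M(2) K(1) by (simp add: field_simps)
    finally show ?thesis .
  qed
  then show "\<exists>d>0. \<forall>a b. dist a p < d \<longrightarrow> dist b p < d \<longrightarrow>
      norm (g (f a) - g (f b) - g' (f' (a - b))) \<le> e * norm (a - b)"
    using \<open>0 < d\<close> by blast
qed

lemma has_strict_derivative_Pair: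
  assumes f: "has_strict_derivative f f' p" and g: "has_strict_derivative g g' p"
  shows "has_strict_derivative (\<lambda>x. (f x, g x)) (\<lambda>h. (f' h, g' h)) p"
proof (rule has_strict_derivativeI)
  show "bounded_linear (\<lambda>h. (f' h, g' h))"
    using f g by (intro bounded_linear_Pair has_strict_derivative_bounded_linear)
  fix e :: real assume "0 < e"
  then have "0 < e / 2" by simp
  obtain d1 where d1: "0 < d1" "\<And>a b. dist a p < d1 \<Longrightarrow> dist b p < d1 \<Longrightarrow>
      norm (f a - f b - f' (a - b)) \<le> e / 2 * norm (a - b)"
    using has_strict_derivativeE[OF f \<open>0 < e / 2\<close>] by blast
  obtain d2 where d2: "0 < d2" "\<And>a b. dist a p < d2 \<Longrightarrow> dist b p < d2 \<Longrightarrow>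
      norm (g a - g b - g' (a - b)) \<le> e / 2 * norm (a - b)"
    using has_strict_derivativeE[OF g \<open>0 < e / 2\<close>] by blast
  have "norm ((f a, g a) - (f b, g b) - (f' (a - b), g' (a - b))) \<le> e * norm (a - b)"
    if "dist a p < min d1 d2" "dist b p < min d1 d2" for a b
  proof -
    have "norm ((f a, g a) - (f b, g b) - (f' (a - b), g' (a - b)))
        \<le> norm (f a - f b - f' (a - b)) + norm (g a - g b - g' (a - b))"
      by (simp add: norm_Pair_le)
    also have "\<dots> \<le> e / 2 * norm (a - b) + e / 2 * norm (a - b)"
      using that by (intro add_mono d1(2) d2(2)) auto
    finally show ?thesis by simp
  qed
  then show "\<exists>d>0. \<forall>a b. dist a p < d \<longrightarrow> dist b p < d \<longrightarrow>
      norm ((f a, g a) - (f b, g b) - (f' (a - b), g' (a - b))) \<le> e * norm (a - b)"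
    using d1(1) d2(1) by (intro exI[of _ "min d1 d2"]) simp
qed

lemma has_strict_derivative_add:
  assumes "has_strict_derivative f f' p" "has_strict_derivative g g' p"
  shows "has_strict_derivative (\<lambda>x. f x + g x) (\<lambda>h. f' h + g' h) p"
proof -
  have "bounded_linear (\<lambda>x. fst x + snd x :: 'b)"
    by (intro bounded_linear_intros)
  from has_strict_derivative_compose[OF has_strict_derivative_Pair[OF assms]
      has_strict_derivative_linear[OF this]]
  show ?thesis by simp
qed

text \<open>By the chain rule it suffices to treat \<open>B\<close> on pairs. There the
  linearization error at (s, t) is B(a1 - s, a2 - b2) + B(a1 - b1, b2 - t): in each term one factor
  is small and the other is a difference of the two points.\<close>

lemma has_strict_derivative_bilinear:
  assumes "bounded_bilinear B"
    and f: "has_strict_derivative f f' p" and g: "has_strict_derivative g g' p"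
  shows "has_strict_derivative (\<lambda>x. B (f x) (g x)) (\<lambda>h. B (f p) (g' h) + B (f' h) (g p)) p"
proof -
  interpret B: bounded_bilinear B by fact
  obtain K where K: "0 < K" "\<And>a b. norm (B a b) \<le> norm a * norm b * K"
    using B.pos_bounded by blast
  have "has_strict_derivative (\<lambda>x. B (fst x) (snd x)) (\<lambda>h. B s (snd h) + B (fst h) t) (s, t)" for s t
  proof (rule has_strict_derivativeI)
    show "bounded_linear (\<lambda>h. B s (snd h) + B (fst h) t)"
      by (intro bounded_linear_add bounded_linear_compose[OF B.bounded_linear_right]
          bounded_linear_compose[OF B.bounded_linear_left] bounded_linear_fst bounded_linear_snd)
    fix e :: real assume "0 < e"
    define d where "d = e / (2 * K)"
    have "0 < d" using \<open>0 < e\<close> K(1) by (simp add: d_def)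
    have "norm (B (fst a) (snd a) - B (fst b) (snd b) - (B s (snd (a - b)) + B (fst (a - b)) t))
        \<le> e * norm (a - b)" if ab: "dist a (s, t) < d" "dist b (s, t) < d" for a b
    proof -
      have "norm (fst a - s) \<le> d" "norm (snd b - t) \<le> d"
        using ab dist_fst_le[of a "(s, t)"] dist_snd_le[of b "(s, t)"] by (auto simp: dist_norm)
      moreover have "norm (fst a - fst b) \<le> norm (a - b)" "norm (snd a - snd b) \<le> norm (a - b)"
        using norm_fst_le[of "fst (a - b)" "snd (a - b)"] norm_snd_le[of "snd (a - b)" "fst (a - b)"]
        unfolding prod.collapse by simp_all
      moreover have "B (fst a) (snd a) - B (fst b) (snd b) - (B s (snd (a - b)) + B (fst (a - b)) t)
          = B (fst a - s) (snd a - snd b) + B (fst a - fst b) (snd b - t)"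
        by (simp add: B.diff_left B.diff_right)
      ultimately have "norm (B (fst a) (snd a) - B (fst b) (snd b) - (B s (snd (a - b)) + B (fst (a - b)) t))
          \<le> d * norm (a - b) * K + norm (a - b) * d * K"
        using K(1) \<open>0 < d\<close> by (simp only:)
          (intro norm_triangle_mono order_trans[OF K(2)] mult_right_mono mult_mono; simp)
      also have "\<dots> = e * norm (a - b)" using K(1) by (simp add: d_def field_simps)
      finally show ?thesis .
    qed
    then show "\<exists>d>0. \<forall>a b. dist a (s, t) < d \<longrightarrow> dist b (s, t) < d \<longrightarrow>
        norm (B (fst a) (snd a) - B (fst b) (snd b) - (B s (snd (a - b)) + B (fst (a - b)) t))
          \<le> e * norm (a - b)"
      using \<open>0 < d\<close> by blast
  qed
  from has_strict_derivative_compose[OF has_strict_derivative_Pair[OF f g] this]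
  show ?thesis by simp
qed

section \<open>An implicit multifunction theorem\<close>

text \<open>If a minimiser \<open>q\<close> of \<open>dist(H(q, w2), C) + \<kappa>/2 \<bar>q - p1\<bar>\<close> near \<open>p\<close> had \<open>H(q, w2) \<notin> C\<close>, the proximal
  normal \<open>e\<close> at the nearest point of \<open>C\<close> would satisfy \<open>\<bar>A\<^sup>* e\<bar> \<le> 3/4 \<kappa> \<bar>e\<bar>\<close>, contradicting the modulus \<open>\<kappa>\<close>. As
  \<open>H(\<cdot>, w2)\<close> need not be differentiable at \<open>q\<close>, the descent direction \<open>-A\<^sup>* e\<close> is tested directly.\<close>

theorem constraint_system_lipschitz:
  fixes H :: "'a::euclidean_space \<times> 'b::real_normed_vector \<Rightarrow> 'c::euclidean_space"
  assumes H: "has_strict_derivative H H' (p, w)" and "closed C"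
    and inj: "\<And>l. l \<in> limiting_normal_cone (H (p, w)) C \<Longrightarrow> adjoint (\<lambda>h. H' (h, 0)) l = 0 \<Longrightarrow> l = 0"
  obtains d L where "0 < d" "0 < L"
    "\<And>w1 w2 p1. dist w1 w < d \<Longrightarrow> dist w2 w < d \<Longrightarrow> dist p1 p < d \<Longrightarrow> H (p1, w1) \<in> C \<Longrightarrow>
       \<exists>p2. H (p2, w2) \<in> C \<and> norm (p1 - p2) \<le> L * norm (w1 - w2)"
proof -
  define A where "A h = H' (h, 0)" for h
  have A: "linear A"
  proof -
    have "bounded_linear (\<lambda>h::'a. (h, 0::'b))" by (intro bounded_linear_intros)
    from bounded_linear_compose[OF has_strict_derivative_bounded_linear[OF H] this]
    show ?thesis by (simp add: A_def [abs_def] bounded_linear.linear)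
  qed
  define B where "B = adjoint A"
  have B: "bounded_linear B"
    using A by (simp add: B_def adjoint_linear flip: linear_conv_bounded_linear)
  have inj': "l = 0" if "l \<in> limiting_normal_cone (H (p, w)) C" "B l = 0" for l
    using inj that by (simp add: B_def A_def [abs_def])
  obtain \<kappa> \<rho> where "0 < \<kappa>" "0 < \<rho>" and modulus: "\<And>c l. c \<in> C \<Longrightarrow> dist c (H (p, w)) < \<rho> \<Longrightarrow>
      l \<in> regular_normal_cone c C \<Longrightarrow> \<kappa> * norm l \<le> norm (B l)"
    by (rule limiting_normal_cone_modulus[OF \<open>closed C\<close> B, of "H (p, w)"]) (use inj' in blast)+
  \<comment> \<open>The error slope \<open>\<kappa> / 4\<close> and the penalty slope
    \<open>\<kappa> / 2\<close> in \<open>g\<close> below add up to \<open>3 / 4 * \<kappa>\<close>,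
    strictly less than the modulus.\<close>
  obtain r1 where "0 < r1" and strict: "\<And>a b. dist a (p, w) < r1 \<Longrightarrow> dist b (p, w) < r1 \<Longrightarrow>
      norm (H a - H b - H' (a - b)) \<le> \<kappa> / 4 * norm (a - b)"
    using has_strict_derivativeE[OF H, of "\<kappa> / 4"] \<open>0 < \<kappa>\<close> by auto
  obtain r2 M where "0 < r2" "0 < M" and lip: "\<And>a b. dist a (p, w) < r2 \<Longrightarrow> dist b (p, w) < r2 \<Longrightarrow>
      norm (H a - H b) \<le> M * norm (a - b)"
    using has_strict_derivative_lipschitz[OF H] by blast
  define r where "r = min r1 r2 / 2"
  have "0 < r" using \<open>0 < r1\<close> \<open>0 < r2\<close> by (simp add: r_def)
  have near: "dist (a, b) (p, w) < r1" "dist (a, b) (p, w) < r2" if "dist a p \<le> r" "dist b w < r" for a b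
    using norm_Pair_le[of "a - p" "b - w"] that by (auto simp: dist_norm r_def)
  \<comment> \<open>A minimiser \<open>q\<close> has |q - p1| <= (2 M / \<kappa>) |w1 - w2| with |w1
    - w2| < 2 d, hence |q - p1| <= d (N - 1) and |q - p| < d N.\<close>
  define N where "N = 1 + 4 * M / \<kappa>"
  have "1 < N" using \<open>0 < M\<close> \<open>0 < \<kappa>\<close> by (simp add: N_def)
  \<comment> \<open>The first bound keeps \<open>q\<close> inside the open ball of radius
    \<open>r\<close>, so that directions can be tested there. The second keeps the nearest point
    \<open>c\<close> within \<open>\<rho>\<close> of \<open>H (p, w)\<close>: its distance is below
    2 M d + M (d N + d) = d M (N + 3).\<close>
  define d where "d = min (r / N) (\<rho> / (M * (N + 3)))"
  have "0 < d" using \<open>0 < r\<close> \<open>1 < N\<close> \<open>0 < M\<close> \<open>0 < \<rho>\<close> by (simp add: d_def)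
  have "d * N \<le> r"
  proof -
    have "d \<le> r / N" by (simp add: d_def)
    then show ?thesis using \<open>1 < N\<close> by (subst (asm) pos_le_divide_eq) auto
  qed
  have "d * 1 < d * N" using \<open>0 < d\<close> \<open>1 < N\<close> by (intro mult_strict_left_mono)
  with \<open>d * N \<le> r\<close> have "d < r" by simp
  have "d * (M * (N + 3)) \<le> \<rho>"
  proof -
    have "d \<le> \<rho> / (M * (N + 3))" by (simp add: d_def)
    then show ?thesis using \<open>1 < N\<close> \<open>0 < M\<close> by (subst (asm) pos_le_divide_eq) auto
  qed
  have "\<exists>p2. H (p2, w2) \<in> C \<and> norm (p1 - p2) \<le> 2 * M / \<kappa> * norm (w1 - w2)"
    if w1: "dist w1 w < d" and w2: "dist w2 w < d" and p1: "dist p1 p < d" and C: "H (p1, w1) \<in> C"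
    for w1 w2 p1
  proof -
    have "C \<noteq> {}" using C by blast
    have w12: "norm (w1 - w2) < 2 * d"
      using w1 w2 norm_triangle_ineq4[of "w1 - w" "w2 - w"] by (simp add: dist_norm)
    \<comment> \<open>As \<open>g p1\<close> is at most \<open>M * norm (w1 - w2)\<close>, the
      penalty term bounds the distance of a minimiser from \<open>p1\<close>; this is the source of
      the final constant \<open>2 * M / \<kappa>\<close>.\<close>
    define g where "g q = infdist (H (q, w2)) C + \<kappa> / 2 * norm (q - p1)" for q
    have "M-lipschitz_on (cball p r) (\<lambda>q. H (q, w2))"
    proof (rule lipschitz_onI)
      fix a b assume "a \<in> cball p r" "b \<in> cball p r"
      then show "dist (H (a, w2)) (H (b, w2)) \<le> M * dist a b"
        using lip[OF near(2) near(2), of a w2 b w2] w2 \<open>d < r\<close>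
        by (simp add: dist_norm norm_minus_commute norm_Pair)
    qed (use \<open>0 < M\<close> in simp)
    then have "continuous_on (cball p r) g"
      unfolding g_def by (intro continuous_intros continuous_on_infdist) (rule lipschitz_on_continuous_on)
    then obtain q where q: "q \<in> cball p r" "\<And>a. a \<in> cball p r \<Longrightarrow> g q \<le> g a"
      using continuous_attains_inf[of "cball p r" g] \<open>0 < r\<close> by auto
    have "p1 \<in> cball p r" using p1 \<open>d < r\<close> by (simp add: dist_commute)
    have "g p1 \<le> M * norm (w1 - w2)"
    proof -
      have "g p1 \<le> dist (H (p1, w2)) (H (p1, w1))" using infdist_le[OF C] by (simp add: g_def)
      also have "\<dots> \<le> M * norm (w1 - w2)"
        using lip[OF near(2) near(2), of p1 w2 p1 w1] p1 w1 w2 \<open>d < r\<close>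
        by (simp add: dist_norm norm_Pair norm_minus_commute)
      finally show ?thesis .
    qed
    then have gq: "g q \<le> M * norm (w1 - w2)" using q(2)[OF \<open>p1 \<in> cball p r\<close>] by simp
    have "\<kappa> / 2 * norm (q - p1) \<le> g q" by (simp add: g_def infdist_nonneg)
    with gq have "\<kappa> / 2 * norm (q - p1) \<le> M * norm (w1 - w2)" by simp
    then have qp1: "norm (q - p1) \<le> 2 * M / \<kappa> * norm (w1 - w2)"
      using \<open>0 < \<kappa>\<close> by (simp add: field_simps)
    also have "\<dots> \<le> 2 * M / \<kappa> * (2 * d)"
      using w12 \<open>0 < M\<close> \<open>0 < \<kappa>\<close> by (intro mult_left_mono) auto
    finally have "norm (q - p1) \<le> d * (N - 1)" by (simp add: N_def mult_ac)
    then have qp: "norm (q - p) < d * N"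
      using norm_triangle_ineq[of "q - p1" "p1 - p"] p1
      unfolding dist_norm right_diff_distrib by simp
    have "H (q, w2) \<in> C"
    proof (rule ccontr)
      assume notin: "H (q, w2) \<notin> C"
      obtain c where c: "c \<in> C" "infdist (H (q, w2)) C = dist (H (q, w2)) c"
        using infdist_attains_inf[OF \<open>closed C\<close> \<open>C \<noteq> {}\<close>] by blast
      define e where "e = H (q, w2) - c"
      have "e \<noteq> 0" using notin c(1) by (auto simp: e_def)
      have e: "e \<in> regular_normal_cone c C"
        unfolding e_def by (rule nearest_point_regular_normal) (metis c(2) infdist_le)
      have "dist c (H (p, w)) < \<rho>"
      proof -
        have "norm e \<le> g q" using \<open>0 < \<kappa>\<close> c(2) by (simp add: g_def e_def dist_norm)
        also note gq
        also have "M * norm (w1 - w2) < M * (2 * d)" using w12 \<open>0 < M\<close> by simp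
        finally have 1: "norm e < M * (2 * d)" .
        have "norm (H (q, w2) - H (p, w)) \<le> M * norm ((q, w2) - (p, w))"
          using q(1) w2 \<open>d < r\<close> \<open>0 < r\<close>
          by (intro lip near) (auto simp: dist_commute)
        also have "\<dots> \<le> M * (d * N + d)"
        proof (rule mult_left_mono)
          show "norm ((q, w2) - (p, w)) \<le> d * N + d"
            using norm_Pair_le[of "q - p" "w2 - w"] qp w2 unfolding dist_norm diff_Pair by linarith
        qed (use \<open>0 < M\<close> in simp)
        finally have 2: "norm (H (q, w2) - H (p, w)) \<le> M * (d * N + d)" .
        have "dist c (H (p, w)) \<le> norm e + norm (H (q, w2) - H (p, w))"
          using norm_triangle_ineq4[of "H (q, w2) - H (p, w)" e] by (simp add: e_def dist_norm)
        also have "\<dots> < d * (M * (N + 3))" using 1 2 by (simp add: algebra_simps)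
        finally show ?thesis using \<open>d * (M * (N + 3)) \<le> \<rho>\<close> by simp
      qed
      with modulus c(1) e have \<kappa>e: "\<kappa> * norm e \<le> norm (B e)" by blast
      \<comment> \<open>Along \<open>u\<close> the norm of the linearized residual falls at rate
        |u|^2 / |e|, which by \<open>\<kappa>e\<close> is at least \<kappa> |u|; minimality of
        \<open>q\<close> tolerates only 3/4 of that rate.\<close>
      define u where "u = - B e"
      have "0 < norm u" using \<kappa>e \<open>e \<noteq> 0\<close> \<open>0 < \<kappa>\<close> unfolding u_def norm_minus_cancel
        by (meson less_le_trans mult_pos_pos zero_less_norm_iff)
      have eAu: "e \<bullet> A u = - (norm u)\<^sup>2"
        using adjoint_works[OF A, of u e] by (simp add: u_def B_def power2_norm_eq_inner inner_commute)
      have small: "\<forall>\<^sub>F t in at_right (0::real). t * a < b" if "0 < b" for a b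
        by (rule order_tendstoD(2)[OF _ that]) (auto intro!: tendsto_eq_intros)
      \<comment> \<open>Besides positivity: \<open>q'\<close> stays in the ball, the left side of
        the inequality below is nonnegative and may be squared, and the quadratic term stays below
        half of |u|^2.\<close>
      have "\<forall>\<^sub>F t in at_right (0::real). 0 < t \<and> t * norm u < r - norm (q - p) \<and>
          t * (3 / 4 * \<kappa> * norm u) < norm e \<and> t * (norm (A u))\<^sup>2 < (norm u)\<^sup>2 / 2"
        using qp \<open>d * N \<le> r\<close> \<open>e \<noteq> 0\<close> \<open>0 < norm u\<close>
        by (intro eventually_conj small eventually_at_right_less) auto
      then obtain t where t: "0 < t" "t * norm u < r - norm (q - p)"
          "t * (3 / 4 * \<kappa> * norm u) < norm e" "t * (norm (A u))\<^sup>2 < (norm u)\<^sup>2 / 2"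
        using eventually_happens'[OF trivial_limit_at_right_real[of 0]] by blast
      define q' where "q' = q + t *\<^sub>R u"
      have q': "q' \<in> cball p r"
        using norm_triangle_ineq[of "q - p" "t *\<^sub>R u"] t(1,2)
        by (simp add: q'_def dist_norm norm_minus_commute algebra_simps)
      define \<eta> where "\<eta> = H (q', w2) - H (q, w2) - t *\<^sub>R A u"
      have "norm \<eta> \<le> \<kappa> / 4 * (t * norm u)"
      proof -
        have "norm (H (q', w2) - H (q, w2) - H' ((q', w2) - (q, w2))) \<le> \<kappa> / 4 * norm ((q', w2) - (q, w2))"
          using q(1) q' w2 \<open>d < r\<close> by (intro strict near) (auto simp: dist_commute)
        moreover have "(q', w2) - (q, w2) = t *\<^sub>R (u, 0)" by (simp add: q'_def)
        moreover have "H' (t *\<^sub>R (u, 0)) = t *\<^sub>R A u"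
          using linear_scale[OF bounded_linear.linear[OF has_strict_derivative_bounded_linear[OF H]]]
          by (metis A_def)
        ultimately show ?thesis using t(1) by (simp add: \<eta>_def norm_Pair)
      qed
      have "norm e + \<kappa> / 2 * norm (q - p1) = g q" using c(2) by (simp add: g_def e_def dist_norm)
      also have "\<dots> \<le> g q'" using q(2)[OF q'] .
      also have "\<dots> \<le> norm (e + t *\<^sub>R A u + \<eta>) + \<kappa> / 2 * norm (q' - p1)"
        using infdist_le[OF c(1), of "H (q', w2)"] by (simp add: g_def e_def \<eta>_def dist_norm)
      also have "\<dots> \<le> norm (e + t *\<^sub>R A u) + \<kappa> / 4 * (t * norm u) + \<kappa> / 2 * (norm (q - p1) + t * norm u)"
      proof (intro add_mono mult_left_mono)
        show "norm (e + t *\<^sub>R A u + \<eta>) \<le> norm (e + t *\<^sub>R A u) + \<kappa> / 4 * (t * norm u)"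
          using \<open>norm \<eta> \<le> _\<close> norm_triangle_ineq[of "e + t *\<^sub>R A u" \<eta>] by simp
        show "norm (q' - p1) \<le> norm (q - p1) + t * norm u"
          using t(1) norm_triangle_ineq[of "q - p1" "t *\<^sub>R u"] by (simp add: q'_def algebra_simps)
      qed (use \<open>0 < \<kappa>\<close> in auto)
      finally have "norm e - t * (3 / 4 * \<kappa> * norm u) \<le> norm (e + t *\<^sub>R A u)"
        by (simp add: algebra_simps)
      then have "(norm e - t * (3 / 4 * \<kappa> * norm u))\<^sup>2 \<le> (norm (e + t *\<^sub>R A u))\<^sup>2"
        using t(3) by (intro power_mono) auto
      also have "\<dots> = (norm e)\<^sup>2 - 2 * t * (norm u)\<^sup>2 + t\<^sup>2 * (norm (A u))\<^sup>2"
      proof -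
        have "(norm (e + t *\<^sub>R A u))\<^sup>2 = (norm e)\<^sup>2 + 2 * t * (e \<bullet> A u) + t\<^sup>2 * (norm (A u))\<^sup>2"
          by (simp only: power2_norm_eq_inner)
             (simp add: inner_add_left inner_add_right inner_commute power2_eq_square)
        then show ?thesis by (simp add: eAu)
      qed
      finally have prems: "(norm e)\<^sup>2 - 2 * norm e * (t * (3 / 4 * \<kappa> * norm u))
          \<le> (norm e)\<^sup>2 - 2 * t * (norm u)\<^sup>2 + t\<^sup>2 * (norm (A u))\<^sup>2"
        using zero_le_power2[of "t * (3 / 4 * \<kappa> * norm u)"] by (simp only: power2_diff)
      \<comment> \<open>After cancelling \<open>t\<close>, the bound \<kappa> |e| <= |u| leaves 2
        |u|^2 <= 3/2 |u|^2 + t |A u|^2, which the choice of \<open>t\<close> excludes.\<close>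
      then have "t * (2 * (norm u)\<^sup>2) \<le> t * (3 / 2 * ((\<kappa> * norm e) * norm u) + t * (norm (A u))\<^sup>2)"
      proof -
        have "2 * norm e * (t * (3 / 4 * \<kappa> * norm u)) = t * (3 / 2 * ((\<kappa> * norm e) * norm u))"
          "2 * t * (norm u)\<^sup>2 = t * (2 * (norm u)\<^sup>2)"
          "t\<^sup>2 * (norm (A u))\<^sup>2 = t * (t * (norm (A u))\<^sup>2)"
          by (simp_all add: power2_eq_square)
        with prems show ?thesis unfolding distrib_left by linarith
      qed
      then have "2 * (norm u)\<^sup>2 \<le> 3 / 2 * ((\<kappa> * norm e) * norm u) + t * (norm (A u))\<^sup>2"
        using t(1) by simp
      also have "\<dots> \<le> 3 / 2 * (norm u * norm u) + t * (norm (A u))\<^sup>2"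
        using \<kappa>e by (intro add_mono mult_left_mono mult_right_mono) (auto simp: u_def)
      finally show False using t(4) by (simp add: power2_eq_square)
    qed
    then show ?thesis using qp1 by (metis norm_minus_commute)
  qed
  then show thesis using that[OF \<open>0 < d\<close>, of "2 * M / \<kappa>"] \<open>0 < M\<close> \<open>0 < \<kappa>\<close> by simp
qed

section \<open>Convex functions that are affine along a subspace\<close>

text \<open>Provides the product rule and joint limits for the adjoint of a varying operator at a
  varying vector. With T' the adjoint, |T' y|^2 = T (T' y) . y <= |T| |T' y| |y|, and one factor |T'
  y| cancels.\<close>

lemma bounded_bilinear_adjoint_blinfun:
  "bounded_bilinear (\<lambda>(T::'a::euclidean_space \<Rightarrow>\<^sub>L 'b::euclidean_space) y. adjoint T y)"
proof
  fix T T' :: "'a \<Rightarrow>\<^sub>L 'b" and y y' :: 'b and r :: real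
  have lin: "linear (blinfun_apply T)" for T :: "'a \<Rightarrow>\<^sub>L 'b"
    by (simp add: blinfun.bounded_linear_right bounded_linear.linear)
  note adj = adjoint_works[OF lin]
  show "adjoint (T + T') y = adjoint T y + adjoint T' y"
    by (rule vector_eq_rdot[THEN iffD1]) (simp add: inner_commute adj inner_add_right blinfun.add_left)
  show "adjoint T (y + y') = adjoint T y + adjoint T y'"
    by (rule linear_add[OF adjoint_linear[OF lin]])
  show "adjoint (r *\<^sub>R T) y = r *\<^sub>R adjoint T y"
    by (rule vector_eq_rdot[THEN iffD1]) (simp add: inner_commute adj blinfun.scaleR_left)
  show "adjoint T (r *\<^sub>R y) = r *\<^sub>R adjoint T y"
    by (rule linear_scale[OF adjoint_linear[OF lin]])
  show "\<exists>K. \<forall>T y. norm (adjoint (blinfun_apply T) y) \<le> norm (T :: 'a \<Rightarrow>\<^sub>L 'b) * norm y * K"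
  proof (intro exI[of _ 1] allI)
    fix T :: "'a \<Rightarrow>\<^sub>L 'b" and y :: 'b
    have "norm (adjoint T y) * norm (adjoint T y) = T (adjoint T y) \<bullet> y"
      by (metis adj power2_eq_square power2_norm_eq_inner)
    also have "\<dots> \<le> norm (T (adjoint T y)) * norm y" by (rule norm_cauchy_schwarz)
    also have "\<dots> \<le> norm T * norm (adjoint T y) * norm y"
      by (intro mult_right_mono norm_blinfun) simp
    finally have "norm (adjoint T y) * norm (adjoint T y) \<le> (norm T * norm y) * norm (adjoint T y)"
      by (simp add: mult_ac)
    then show "norm (adjoint T y) \<le> norm T * norm y * 1"
      by (cases "adjoint T y = 0") auto
  qed
qed

text \<open>\<open>g\<close> is total and globally Lipschitz, so continuity and epigraph estimates
  need no care at the boundary of \<open>D\<close>. \<open>shift\<close> is assumed at all points of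
  \<open>D\<close> near \<open>zb\<close>, because limiting normals come from nearby graph points;
  the slope there is still \<open>yb\<close>. The radius \<open>\<rho>\<close> bounds both the base
  point and the shift.\<close>

locale partly_affine =
  fixes \<theta> :: "'z::euclidean_space \<Rightarrow> ereal" and D :: "'z set" and g :: "'z \<Rightarrow> real"
    and M :: real and S :: "'z set" and zb yb :: 'z and \<rho> :: real
  assumes \<theta>_eq: "\<And>z. \<theta> z = (if z \<in> D then ereal (g z) else \<infinity>)"
    and closed_D: "closed D" and convex_D: "convex D" and convex_g: "convex_on D g"
    and lipschitz_g: "\<And>a b. \<bar>g a - g b\<bar> \<le> M * norm (a - b)"
    and subspace_S: "subspace S"
    and yb: "yb \<in> convex_subdifferential \<theta> zb"
    and \<rho>_pos: "0 < \<rho>"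
    and shift: "\<And>z s. z \<in> D \<Longrightarrow> dist z zb < \<rho> \<Longrightarrow> s \<in> orthogonal_comp S \<Longrightarrow> norm s < \<rho> \<Longrightarrow>
        z + s \<in> D \<and> g (z + s) = g z + yb \<bullet> s"
begin

lemma subdifferential_iff:
  "y \<in> convex_subdifferential \<theta> z \<longleftrightarrow> z \<in> D \<and> (\<forall>z'\<in>D. g z + y \<bullet> (z' - z) \<le> g z')"
  by (auto simp: convex_subdifferential_def \<theta>_eq)

lemma M_nonneg: "0 \<le> M"
proof -
  obtain b :: 'z where "b \<in> Basis" using nonempty_Basis by blast
  then show ?thesis using lipschitz_g[of b 0] by simp
qed

lemma continuous_g: "continuous_on UNIV g"
  by (rule lipschitz_on_continuous_on[of M]) (auto intro!: lipschitz_onI simp: dist_norm lipschitz_g M_nonneg)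

text \<open>For each fixed \<open>z'\<close> the subgradient inequality is a closed condition on
  point and subgradient jointly, because \<open>g\<close> is continuous.\<close>

lemma closed_graph: "closed (gph (convex_subdifferential \<theta>))"
proof -
  have "continuous_on UNIV (\<lambda>p. g (fst p))"
    by (rule continuous_on_compose2[OF continuous_g continuous_on_fst]) (auto intro: continuous_intros)
  then have "closed {p. g (fst p) + snd p \<bullet> (z' - fst p) \<le> g z'}" for z'
    by (intro closed_Collect_le continuous_intros)
  then have "closed (D \<times> UNIV \<inter> (\<Inter>z'\<in>D. {p. g (fst p) + snd p \<bullet> (z' - fst p) \<le> g z'}))"
    using closed_D by (intro closed_Int closed_Times closed_INT ballI) auto
  moreover have "gph (convex_subdifferential \<theta>)
      = D \<times> UNIV \<inter> (\<Inter>z'\<in>D. {p. g (fst p) + snd p \<bullet> (z' - fst p) \<le> g z'})"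
    by (auto simp: gph_def subdifferential_iff)
  ultimately show ?thesis by simp
qed

section \<open>Subgradients and graph normals relative to the subspace \<open>S\<close>\<close>

lemma in_S_iff: "q \<in> S \<longleftrightarrow> (\<forall>s\<in>orthogonal_comp S. q \<bullet> s = 0)"
  using orthogonal_comp_self[OF subspace_S]
  by (auto simp: orthogonal_comp_def orthogonal_def inner_commute set_eq_iff)

lemma neg_orthogonal_comp: "s \<in> orthogonal_comp S \<Longrightarrow> - s \<in> orthogonal_comp S"
  by (rule subspace_neg[OF subspace_orthogonal_comp])

text \<open>Along a small multiple of \<open>s\<close> the function \<open>g\<close> is affine with
  slope \<open>yb\<close>, so the subgradient inequality gives y . s <= yb . s; the direction
  \<open>-s\<close> gives the converse.\<close>

lemma subgradient_along_complement:
  assumes y: "y \<in> convex_subdifferential \<theta> z" and z: "dist z zb < \<rho>"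
    and s: "s \<in> orthogonal_comp S"
  shows "y \<bullet> s = yb \<bullet> s"
proof -
  have le: "y \<bullet> s \<le> yb \<bullet> s" if s: "s \<in> orthogonal_comp S" for s
  proof -
    define t where "t = \<rho> / (norm s + 1) / 2"
    have "0 < norm s + 1" by (simp add: add_nonneg_pos)
    then have t: "0 < t" "t * norm s < \<rho>" using \<rho>_pos
    proof -
      show "0 < t" using \<rho>_pos \<open>0 < norm s + 1\<close> by (simp add: t_def)
      have "t * norm s \<le> t * (norm s + 1)" using \<open>0 < t\<close> by simp
      also have "\<dots> = \<rho> / 2" using \<open>0 < norm s + 1\<close> unfolding t_def by (simp add: field_simps)
      also have "\<dots> < \<rho>" using \<rho>_pos by simp
      finally show "t * norm s < \<rho>" .
    qed
    have "z \<in> D" using y by (simp add: subdifferential_iff)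
    moreover have "t *\<^sub>R s \<in> orthogonal_comp S"
      using s by (rule subspace_scale[OF subspace_orthogonal_comp])
    ultimately have "z + t *\<^sub>R s \<in> D" "g (z + t *\<^sub>R s) = g z + yb \<bullet> (t *\<^sub>R s)"
      using shift[of z "t *\<^sub>R s"] z t by auto
    then have "y \<bullet> (t *\<^sub>R s) \<le> yb \<bullet> (t *\<^sub>R s)"
      using y unfolding subdifferential_iff by (metis add_diff_cancel_left' add_le_cancel_left)
    then show ?thesis using t(1) by simp
  qed
  from le[OF s] le[OF neg_orthogonal_comp[OF s]] show ?thesis by simp
qed

text \<open>Subgradients at all points near \<open>zb\<close> share one translate of
  \<open>S\<close>, on which nondegeneracy controls the adjoint; every bound on multipliers comes
  from here.\<close>

lemma subgradient_diff_in_S: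
  assumes "y \<in> convex_subdifferential \<theta> z" "dist z zb < \<rho>"
  shows "y - yb \<in> S"
  using subgradient_along_complement[OF assms] by (simp add: in_S_iff inner_diff_left)

text \<open>The shift changes the value of \<open>g\<close> by yb . s and the linear term by y . s,
  and these agree. The graph is thus locally invariant under moves of its first component orthogonal
  to \<open>S\<close>.\<close>

lemma subgradient_shift:
  assumes y: "y \<in> convex_subdifferential \<theta> z" and z: "dist z zb < \<rho>"
    and s: "s \<in> orthogonal_comp S" "norm s < \<rho>"
  shows "y \<in> convex_subdifferential \<theta> (z + s)"
proof -
  have "z \<in> D" and le: "\<And>z'. z' \<in> D \<Longrightarrow> g z + y \<bullet> (z' - z) \<le> g z'"
    using y by (auto simp: subdifferential_iff)
  note sh = shift[OF \<open>z \<in> D\<close> z s]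
  have "g (z + s) + y \<bullet> (z' - (z + s)) \<le> g z'" if "z' \<in> D" for z'
    using le[OF that] sh subgradient_along_complement[OF y z s(1)]
    by (simp add: inner_diff_right inner_add_right)
  then show ?thesis using sh by (simp add: subdifferential_iff)
qed

text \<open>By the invariance under shifts the graph contains short segments in the directions (s,
  0) and (-s, 0), so the first component of a nearby regular normal is orthogonal to
  \<open>s\<close>. As \<open>S\<close> is closed, limits stay in it.\<close>

lemma normal_to_graph_in_S:
  assumes "(q, r) \<in> limiting_normal_cone (zb, y) (gph (convex_subdifferential \<theta>))"
  shows "q \<in> S"
proof -
  obtain P V where P: "\<And>k. P k \<in> gph (convex_subdifferential \<theta>)" "P \<longlonglongrightarrow> (zb, y)"
    and V: "\<And>k. V k \<in> regular_normal_cone (P k) (gph (convex_subdifferential \<theta>))" "V \<longlonglongrightarrow> (q, r)"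
    using limiting_normal_coneE[OF assms] by metis
  have "(\<lambda>k. fst (P k)) \<longlonglongrightarrow> zb" using tendsto_fst[OF P(2)] by simp
  then have near: "\<forall>\<^sub>F k in sequentially. dist (fst (P k)) zb < \<rho>"
    using \<rho>_pos by (rule tendstoD)
  have "\<forall>\<^sub>F k in sequentially. fst (V k) \<in> S"
    using near
  proof eventually_elim
    case (elim k)
    have le: "fst (V k) \<bullet> s \<le> 0" if s: "s \<in> orthogonal_comp S" for s
    proof -
      have "V k \<bullet> (s, 0) \<le> 0"
      proof (rule regular_normal_cone_direction[OF V(1)])
        show "0 < \<rho> / (norm s + 1)" using \<rho>_pos by (simp add: add_nonneg_pos)
        fix t :: real assume t: "0 < t" "t < \<rho> / (norm s + 1)"
        have "t * norm s \<le> t * (norm s + 1)" using t by simp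
        also have "\<dots> < \<rho>" using t by (simp add: pos_less_divide_eq add_nonneg_pos)
        finally have "norm (t *\<^sub>R s) < \<rho>" using t by simp
        moreover have "t *\<^sub>R s \<in> orthogonal_comp S"
          using s by (rule subspace_scale[OF subspace_orthogonal_comp])
        moreover have "snd (P k) \<in> convex_subdifferential \<theta> (fst (P k))"
          using P(1)[of k] by (auto simp: gph_def)
        ultimately have "snd (P k) \<in> convex_subdifferential \<theta> (fst (P k) + t *\<^sub>R s)"
          using elim by (intro subgradient_shift)
        then show "P k + t *\<^sub>R (s, 0) \<in> gph (convex_subdifferential \<theta>)"
          by (cases "P k") (simp add: gph_def)
      qed
      then show ?thesis by (simp add: inner_prod_def)
    qed
    show ?case unfolding in_S_iff
    proof
      fix s assume "s \<in> orthogonal_comp S"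
      with le[of s] le[OF neg_orthogonal_comp[of s]] show "fst (V k) \<bullet> s = 0" by simp
    qed
  qed
  moreover have "(\<lambda>k. fst (V k)) \<longlonglongrightarrow> q" using tendsto_fst[OF V(2)] by simp
  ultimately show ?thesis
    using Lim_in_closed_set[OF closed_subspace[OF subspace_S]] by force
qed

section \<open>The chain rule under nondegeneracy\<close>

text \<open>Applying the implicit theorem to \<open>\<Psi>(p) - \<omega> \<in> S\<^sup>\<bottom>\<close> yields points \<open>x2 = x + t \<xi> + o(t)\<close> whose images differ
  from \<open>\<Psi>(x) + t \<zeta>\<close> only by elements of \<open>S\<^sup>\<bottom>\<close>, along which \<open>g\<close> is affine.\<close>

lemma regular_subgradient_inequality:
  fixes \<Psi> :: "'x::euclidean_space \<Rightarrow> 'z"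
  assumes \<Psi>: "has_strict_derivative \<Psi> A x" and x: "\<Psi> x \<in> D" "dist (\<Psi> x) zb < \<rho>"
    and inj: "\<And>q. q \<in> S \<Longrightarrow> adjoint A q = 0 \<Longrightarrow> q = 0"
    and v: "\<And>e. 0 < e \<Longrightarrow> \<exists>d>0. \<forall>x'. dist x' x < d \<longrightarrow> \<Psi> x' \<in> D \<longrightarrow>
        g (\<Psi> x) + v \<bullet> (x' - x) - e * norm (x' - x) \<le> g (\<Psi> x')"
    and \<zeta>: "\<Psi> x + \<zeta> \<in> D" and \<xi>: "A \<xi> - \<zeta> \<in> orthogonal_comp S"
  shows "v \<bullet> \<xi> \<le> g (\<Psi> x + \<zeta>) - g (\<Psi> x) + yb \<bullet> (A \<xi> - \<zeta>)"
proof -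
  interpret A: bounded_linear A using \<Psi> by (rule has_strict_derivative_bounded_linear)
  \<comment> \<open>The second argument is the prescribed image: a constraint value in the
    complement of \<open>S\<close> means that the image is attained up to an element along which
    \<open>g\<close> is affine.\<close>
  define H where "H p = \<Psi> (fst p) - snd p" for p :: "'x \<times> 'z"
  define H' where "H' p = A (fst p) - snd p" for p :: "'x \<times> 'z"
  have H: "has_strict_derivative H H' (x, \<Psi> x)"
  proof -
    have "has_strict_derivative (\<lambda>p. \<Psi> (fst p)) (\<lambda>p. A (fst p)) (x, \<Psi> x)"
      by (rule has_strict_derivative_compose[OF has_strict_derivative_linear[OF bounded_linear_fst]])
         (simp add: \<Psi>)
    moreover have "has_strict_derivative (\<lambda>p. - snd p) (\<lambda>p. - snd p) (x, \<Psi> x)"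
      by (intro has_strict_derivative_linear bounded_linear_minus bounded_linear_snd)
    ultimately show ?thesis
      using has_strict_derivative_add unfolding H_def H'_def by fastforce
  qed
  \<comment> \<open>In a subspace both \<open>s\<close> and \<open>-s\<close> are admissible
    directions, so its normals lie in the double complement, which is \<open>S\<close>; the
    qualification then reduces to \<open>inj\<close>.\<close>
  have normal: "l \<in> S" if l: "l \<in> limiting_normal_cone h (orthogonal_comp S)" for l h
  proof -
    obtain P V where P: "\<And>k. P k \<in> orthogonal_comp S"
      and V: "\<And>k. V k \<in> regular_normal_cone (P k) (orthogonal_comp S)" "V \<longlonglongrightarrow> l"
      using limiting_normal_coneE[OF l] by metis
    have "V k \<in> S" for k
    proof -
      have le: "V k \<bullet> s \<le> 0" if "s \<in> orthogonal_comp S" for s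
        using that P[of k]
        by (intro regular_normal_cone_direction[OF V(1) zero_less_one])
           (auto intro: subspace_add subspace_scale subspace_orthogonal_comp)
      show ?thesis unfolding in_S_iff
      proof
        fix s assume "s \<in> orthogonal_comp S"
        with le[of s] le[OF neg_orthogonal_comp[of s]] show "V k \<bullet> s = 0" by simp
      qed
    qed
    then show ?thesis using V(2) closed_sequentially[OF closed_subspace[OF subspace_S]] by blast
  qed
  have inj': "l = 0" if "l \<in> limiting_normal_cone (H (x, \<Psi> x)) (orthogonal_comp S)"
      "adjoint (\<lambda>h. H' (h, 0)) l = 0" for l
    using inj normal that by (simp add: H'_def [abs_def])
  obtain d L where "0 < d" "0 < L" and implicit:
    "\<And>w1 w2 p1. dist w1 (\<Psi> x) < d \<Longrightarrow> dist w2 (\<Psi> x) < d \<Longrightarrow> dist p1 x < d \<Longrightarrow>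
       H (p1, w1) \<in> orthogonal_comp S \<Longrightarrow>
       \<exists>p2. H (p2, w2) \<in> orthogonal_comp S \<and> norm (p1 - p2) \<le> L * norm (w1 - w2)"
    by (rule constraint_system_lipschitz[OF H closed_subspace[OF subspace_orthogonal_comp]])
       (use inj' in blast)+
  define s where "s = A \<xi> - \<zeta>"
  obtain K where K: "0 < K" "\<And>h. norm (A h) \<le> norm h * K" using A.pos_bounded by blast
  \<comment> \<open>\<open>N\<close> will bound |x2 - x| / t. The three summands of \<open>c\<close>
    pay for v . r, for e |x2 - x| and for yb . (A r + \<mu>).\<close>
  define N where "N = norm \<xi> + L"
  have "0 < N" using \<open>0 < L\<close> by (simp add: N_def add_nonneg_pos)
  define c where "c = norm v * L + N + norm yb * (K * L + N)"
  have "0 < c" using \<open>0 < L\<close> \<open>0 < N\<close> K(1) by (simp add: c_def add_nonneg_pos add_pos_nonneg)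
  have approx: "v \<bullet> \<xi> \<le> g (\<Psi> x + \<zeta>) - g (\<Psi> x) + yb \<bullet> s + e * c" if e: "0 < e" "e \<le> 1" for e
  proof -
    obtain d1 where "0 < d1" and d1: "\<And>a b. dist a x < d1 \<Longrightarrow> dist b x < d1 \<Longrightarrow>
        norm (\<Psi> a - \<Psi> b - A (a - b)) \<le> e * norm (a - b)"
      using has_strict_derivativeE[OF \<Psi> \<open>0 < e\<close>] by blast
    have "0 < e / N" using \<open>0 < e\<close> \<open>0 < N\<close> by simp
    obtain d2 where "0 < d2" and d2: "\<And>a b. dist a x < d2 \<Longrightarrow> dist b x < d2 \<Longrightarrow>
        norm (\<Psi> a - \<Psi> b - A (a - b)) \<le> e / N * norm (a - b)"
      using has_strict_derivativeE[OF \<Psi> \<open>0 < e / N\<close>] by blast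
    obtain d3 where "0 < d3" and d3: "\<And>x'. dist x' x < d3 \<Longrightarrow> \<Psi> x' \<in> D \<Longrightarrow>
        g (\<Psi> x) + v \<bullet> (x' - x) - e * norm (x' - x) \<le> g (\<Psi> x')"
      using v[OF \<open>0 < e\<close>] by blast
    have small: "\<forall>\<^sub>F t in at_right (0::real). t * a < b" if "0 < b" for a b
      by (rule order_tendstoD(2)[OF _ that]) (auto intro!: tendsto_eq_intros)
    \<comment> \<open>Every displacement below is at most \<open>t\<close> times a partial sum of
      \<open>R\<close>, so smallness of \<open>t * R\<close> covers them all.\<close>
    define R where "R = norm s + norm \<xi> * K + norm \<zeta> + norm \<xi> + N + e + (norm s + K * L + e * N)"
    have "\<forall>\<^sub>F t in at_right (0::real). 0 < t \<and> t * 1 < 1 \<and> t * R < d \<and> t * R < d1 \<and> t * R < d2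
        \<and> t * R < d3 \<and> t * R < \<rho> \<and> t * R < \<rho> - dist (\<Psi> x) zb"
      using \<open>0 < d\<close> \<open>0 < d1\<close> \<open>0 < d2\<close> \<open>0 < d3\<close> \<rho>_pos x(2)
      by (intro eventually_conj small eventually_at_right_less) auto
    then obtain t where t: "0 < t" "t * 1 < 1" "t * R < d" "t * R < d1" "t * R < d2" "t * R < d3"
        "t * R < \<rho>" "t * R < \<rho> - dist (\<Psi> x) zb"
      using eventually_happens'[OF trivial_limit_at_right_real[of 0]] by blast
    have nonneg: "0 \<le> norm \<xi> * K" "0 \<le> K * L" "0 \<le> e * N" using K(1) \<open>0 < L\<close> \<open>0 < e\<close> \<open>0 < N\<close> by auto
    have tR: "t * r \<le> t * R" if "r \<le> R" for r using t(1) that by simp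
    have "norm \<xi> \<le> R" "norm \<zeta> \<le> R" "N \<le> R" "norm s + norm \<xi> * K + e \<le> R"
      "norm s + K * L + e * N \<le> R"
      unfolding R_def using nonneg e(1) \<open>0 < N\<close> norm_ge_zero[of s] norm_ge_zero[of \<xi>] norm_ge_zero[of \<zeta>]
      by linarith+
    note b\<xi> = tR[OF this(1)] and b\<zeta> = tR[OF this(2)] and bN = tR[OF this(3)]
      and bw = tR[OF this(4)] and bs = tR[OF this(5)]
    define \<eta> where "\<eta> = \<Psi> (x + t *\<^sub>R \<xi>) - \<Psi> x - t *\<^sub>R A \<xi>"
    have \<eta>: "norm \<eta> \<le> e * t"
    proof -
      have "norm \<eta> \<le> e / N * norm (t *\<^sub>R \<xi>)"
        using d2[of "x + t *\<^sub>R \<xi>" x] t(1) le_less_trans[OF b\<xi> t(5)] \<open>0 < d2\<close> by (simp add: \<eta>_def dist_norm A.scaleR)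
      also have "\<dots> \<le> e / N * (t * N)"
        using t(1) \<open>0 < e / N\<close> \<open>0 < L\<close> by (intro mult_left_mono) (auto simp: N_def)
      finally show ?thesis using \<open>0 < N\<close> by simp
    qed
    \<comment> \<open>For this parameter \<open>x + t *\<^sub>R \<xi>\<close> is an exact solution
      with constraint value \<open>t *\<^sub>R s\<close>. It differs from the desired parameter only
      by \<open>\<eta>\<close>, of norm at most \<open>e * t\<close>, so the correction of the point
      is equally small.\<close>
    define w1 where "w1 = \<Psi> (x + t *\<^sub>R \<xi>) - t *\<^sub>R s"
    have "\<exists>p2. H (p2, \<Psi> x + t *\<^sub>R \<zeta>) \<in> orthogonal_comp S
        \<and> norm (x + t *\<^sub>R \<xi> - p2) \<le> L * norm (w1 - (\<Psi> x + t *\<^sub>R \<zeta>))"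
    proof (rule implicit)
      have "w1 - \<Psi> x = \<eta> + (t *\<^sub>R A \<xi> - t *\<^sub>R s)" by (simp add: w1_def \<eta>_def)
      then have "norm (w1 - \<Psi> x) \<le> norm \<eta> + (norm (t *\<^sub>R A \<xi>) + norm (t *\<^sub>R s))"
        by (simp only:) (intro norm_triangle_le add_left_mono norm_triangle_ineq4)
      also have "\<dots> \<le> e * t + (t * (norm \<xi> * K) + t * norm s)"
        using t(1) K(2)[of \<xi>] \<eta> by (intro add_mono) auto
      also have "\<dots> = t * (norm s + norm \<xi> * K + e)" by (simp add: algebra_simps)
      finally show "dist w1 (\<Psi> x) < d" using le_less_trans[OF bw t(3)] by (simp add: dist_norm)
      show "dist (\<Psi> x + t *\<^sub>R \<zeta>) (\<Psi> x) < d" "dist (x + t *\<^sub>R \<xi>) x < d"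
        using t(1) le_less_trans[OF b\<zeta> t(3)] le_less_trans[OF b\<xi> t(3)] by (simp_all add: dist_norm)
      show "H (x + t *\<^sub>R \<xi>, w1) \<in> orthogonal_comp S"
        using \<xi> by (simp add: H_def w1_def s_def subspace_scale[OF subspace_orthogonal_comp])
    qed
    moreover have "w1 - (\<Psi> x + t *\<^sub>R \<zeta>) = \<eta>"
      by (simp add: w1_def \<eta>_def s_def scaleR_diff_right)
    ultimately obtain x2 where x2: "\<Psi> x2 - (\<Psi> x + t *\<^sub>R \<zeta>) \<in> orthogonal_comp S"
        and "norm (x + t *\<^sub>R \<xi> - x2) \<le> L * norm \<eta>"
      by (auto simp: H_def)
    define r where "r = x2 - x - t *\<^sub>R \<xi>"
    have r: "norm r \<le> t * (e * L)"
    proof -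
      have "norm r \<le> L * norm \<eta>"
        using \<open>norm (x + t *\<^sub>R \<xi> - x2) \<le> _\<close>
        by (metis r_def diff_diff_eq norm_minus_commute)
      also have "\<dots> \<le> L * (e * t)" using \<eta> \<open>0 < L\<close> by simp
      finally show ?thesis by (simp add: mult_ac)
    qed
    have x2x: "norm (x2 - x) \<le> t * N"
    proof -
      have "norm (x2 - x) \<le> t * norm \<xi> + norm r"
        using norm_triangle_ineq[of "t *\<^sub>R \<xi>" r] t(1) by (simp add: r_def)
      also have "\<dots> \<le> t * norm \<xi> + t * (1 * L)"
        using t(1) e \<open>0 < L\<close> by (intro add_left_mono order_trans[OF r] mult_left_mono mult_right_mono) auto
      finally show ?thesis by (simp add: N_def algebra_simps)
    qed
    \<comment> \<open>Of the displacement of the image, convexity along the segment treats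
      \<open>t *\<^sub>R \<zeta>\<close> and \<open>shift\<close> treats the rest \<open>s2\<close>,
      which is \<open>t *\<^sub>R s\<close> up to a small error.\<close>
    define s2 where "s2 = \<Psi> x2 - (\<Psi> x + t *\<^sub>R \<zeta>)"
    define \<mu> where "\<mu> = \<Psi> x2 - \<Psi> x - A (x2 - x)"
    have \<mu>: "norm \<mu> \<le> t * (e * N)"
    proof -
      have "norm \<mu> \<le> e * norm (x2 - x)"
        using d1[of x2 x] le_less_trans[OF x2x le_less_trans[OF bN t(4)]] \<open>0 < d1\<close> by (simp add: \<mu>_def dist_norm)
      also have "\<dots> \<le> e * (t * N)" using x2x \<open>0 < e\<close> by simp
      finally show ?thesis by (simp add: mult_ac)
    qed
    have s2: "s2 = t *\<^sub>R s + (A r + \<mu>)"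
      by (simp add: s2_def \<mu>_def s_def r_def A.diff A.scaleR scaleR_diff_right)
    have Ar\<mu>: "norm (A r + \<mu>) \<le> t * (e * (K * L + N))"
    proof -
      have "norm (A r + \<mu>) \<le> norm r * K + norm \<mu>" by (intro norm_triangle_mono K(2) order_refl)
      also have "\<dots> \<le> t * (e * L) * K + t * (e * N)"
        using r \<mu> K(1) by (intro add_mono mult_right_mono) auto
      finally show ?thesis by (simp add: algebra_simps)
    qed
    have "norm s2 \<le> t * norm s + t * (e * (K * L + N))"
      unfolding s2 using Ar\<mu> t(1) by (intro norm_triangle_mono) auto
    also have "\<dots> \<le> t * (norm s + K * L + e * N)"
    proof -
      have "e * (K * L) \<le> 1 * (K * L)" using e nonneg(2) by (intro mult_right_mono)
      then have "norm s + e * (K * L + N) \<le> norm s + K * L + e * N" by (simp add: algebra_simps)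
      then show ?thesis using t(1) by (simp flip: distrib_left)
    qed
    also have "\<dots> < \<rho>" using le_less_trans[OF bs t(7)] by simp
    finally have "norm s2 < \<rho>" .
    have conv: "\<Psi> x + t *\<^sub>R \<zeta> = (1 - t) *\<^sub>R \<Psi> x + t *\<^sub>R (\<Psi> x + \<zeta>)"
      by (simp add: algebra_simps)
    have "\<Psi> x + t *\<^sub>R \<zeta> \<in> D"
      unfolding conv using convexD[OF convex_D x(1) \<zeta>, of "1 - t" t] t by simp
    moreover have "dist (\<Psi> x + t *\<^sub>R \<zeta>) zb < \<rho>"
      using norm_triangle_ineq[of "\<Psi> x - zb" "t *\<^sub>R \<zeta>"] t(1) le_less_trans[OF b\<zeta> t(8)]
      unfolding dist_norm by (simp add: add_diff_eq diff_add_eq)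
    ultimately have "\<Psi> x + t *\<^sub>R \<zeta> + s2 \<in> D"
        "g (\<Psi> x + t *\<^sub>R \<zeta> + s2) = g (\<Psi> x + t *\<^sub>R \<zeta>) + yb \<bullet> s2"
      using shift[of "\<Psi> x + t *\<^sub>R \<zeta>" s2] x2 \<open>norm s2 < \<rho>\<close> by (auto simp: s2_def)
    then have \<Psi>x2: "\<Psi> x2 \<in> D" "g (\<Psi> x2) = g (\<Psi> x + t *\<^sub>R \<zeta>) + yb \<bullet> s2"
      by (simp_all add: s2_def)
    have "g (\<Psi> x) + v \<bullet> (x2 - x) - e * norm (x2 - x) \<le> g (\<Psi> x + t *\<^sub>R \<zeta>) + yb \<bullet> s2"
      using d3[of x2] \<Psi>x2 le_less_trans[OF x2x le_less_trans[OF bN t(6)]] by (simp add: dist_norm)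
    also have "g (\<Psi> x + t *\<^sub>R \<zeta>) \<le> (1 - t) * g (\<Psi> x) + t * g (\<Psi> x + \<zeta>)"
      unfolding conv using convex_onD[OF convex_g, of t "\<Psi> x" "\<Psi> x + \<zeta>"] t x(1) \<zeta> by simp
    finally have main: "v \<bullet> (x2 - x) - e * norm (x2 - x) \<le> t * (g (\<Psi> x + \<zeta>) - g (\<Psi> x)) + yb \<bullet> s2"
      by (simp add: algebra_simps)
    have "v \<bullet> (x2 - x) = t * (v \<bullet> \<xi>) + v \<bullet> r" by (simp add: r_def inner_diff_right)
    moreover have "- (v \<bullet> r) \<le> t * (e * (norm v * L))"
    proof -
      have "- (v \<bullet> r) \<le> norm v * norm r" using norm_cauchy_schwarz[of "- v" r] by simp
      also have "\<dots> \<le> norm v * (t * (e * L))" using r by (rule mult_left_mono) simp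
      finally show ?thesis by (simp add: mult_ac)
    qed
    moreover have "e * norm (x2 - x) \<le> t * (e * N)"
      using mult_left_mono[OF x2x, of e] \<open>0 < e\<close> by (simp add: mult_ac)
    moreover have "yb \<bullet> s2 \<le> t * (yb \<bullet> s) + t * (e * (norm yb * (K * L + N)))"
    proof -
      have "yb \<bullet> (A r + \<mu>) \<le> norm yb * norm (A r + \<mu>)" by (rule norm_cauchy_schwarz)
      also have "\<dots> \<le> norm yb * (t * (e * (K * L + N)))" using Ar\<mu> by (rule mult_left_mono) simp
      finally show ?thesis by (simp add: s2 inner_add_right mult_ac)
    qed
    ultimately have "t * (v \<bullet> \<xi>) \<le> t * (g (\<Psi> x + \<zeta>) - g (\<Psi> x)) + t * (yb \<bullet> s)
        + t * (e * (norm v * L)) + t * (e * N) + t * (e * (norm yb * (K * L + N)))"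
      using main by linarith
    also have "\<dots> = t * (g (\<Psi> x + \<zeta>) - g (\<Psi> x) + yb \<bullet> s + e * c)"
      by (simp add: c_def distrib_left)
    finally show ?thesis using t(1) by simp
  qed
  show ?thesis
  proof (rule field_le_epsilon)
    fix e :: real assume "0 < e"
    define e' where "e' = min 1 (e / c)"
    have "0 < e'" "e' \<le> 1" using \<open>0 < e\<close> \<open>0 < c\<close> by (auto simp: e'_def)
    moreover have "e' * c \<le> e"
    proof -
      have "e' \<le> e / c" by (simp add: e'_def)
      then show ?thesis using \<open>0 < c\<close> by (simp add: pos_le_divide_eq)
    qed
    ultimately show "v \<bullet> \<xi> \<le> g (\<Psi> x + \<zeta>) - g (\<Psi> x) + yb \<bullet> (A \<xi> - \<zeta>) + e"
      using approx[of e'] by (simp add: s_def)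
  qed
qed

text \<open>With \<zeta> = 0 the inequality holds for \<xi> and -\<xi> whenever A \<xi> is
  orthogonal to \<open>S\<close>; hence v minus the adjoint at \<open>yb\<close> is the adjoint at
  some q in \<open>S\<close>, and yb + q is the candidate. By nondegeneracy every z' - \<Psi> x
  equals A \<xi> plus a vector orthogonal to \<open>S\<close>; since q annihilates that vector, the
  inequality for this \<xi> is the subgradient inequality at z'.\<close>

lemma regular_subgradient_factorizes:
  fixes \<Psi> :: "'x::euclidean_space \<Rightarrow> 'z"
  assumes \<Psi>: "has_strict_derivative \<Psi> A x" and x: "\<Psi> x \<in> D" "dist (\<Psi> x) zb < \<rho>"
    and inj: "\<And>q. q \<in> S \<Longrightarrow> adjoint A q = 0 \<Longrightarrow> q = 0"
    and v: "\<And>e. 0 < e \<Longrightarrow> \<exists>d>0. \<forall>x'. dist x' x < d \<longrightarrow> \<Psi> x' \<in> D \<longrightarrow>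
        g (\<Psi> x) + v \<bullet> (x' - x) - e * norm (x' - x) \<le> g (\<Psi> x')"
  obtains y where "y \<in> convex_subdifferential \<theta> (\<Psi> x)" "adjoint A y = v"
proof -
  have A: "linear A"
    using has_strict_derivative_bounded_linear[OF \<Psi>] by (rule bounded_linear.linear)
  note adj = adjoint_works[OF A]
  have ineq: "v \<bullet> \<xi> \<le> g (\<Psi> x + \<zeta>) - g (\<Psi> x) + yb \<bullet> (A \<xi> - \<zeta>)"
    if "\<Psi> x + \<zeta> \<in> D" "A \<xi> - \<zeta> \<in> orthogonal_comp S" for \<xi> \<zeta>
    by (rule regular_subgradient_inequality[OF \<Psi> x _ v that]) (use inj in blast)+
  define T where "T = adjoint A ` S"
  have "subspace T"
    unfolding T_def using A subspace_S by (intro linear_subspace_image adjoint_linear)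
  have "v - adjoint A yb \<in> orthogonal_comp (orthogonal_comp T)"
    unfolding orthogonal_comp_def[of "orthogonal_comp T"]
  proof (intro CollectI ballI)
    fix \<xi> assume \<xi>: "\<xi> \<in> orthogonal_comp T"
    have le: "v \<bullet> \<xi> \<le> yb \<bullet> A \<xi>" if "\<xi> \<in> orthogonal_comp T" for \<xi>
    proof -
      have "A \<xi> - 0 \<in> orthogonal_comp S"
        using that by (auto simp: orthogonal_comp_def orthogonal_def T_def adj inner_commute)
      with ineq[of 0 \<xi>] x(1) show ?thesis by simp
    qed
    have "v \<bullet> \<xi> = yb \<bullet> A \<xi>"
      using le[OF \<xi>] le[OF subspace_neg[OF subspace_orthogonal_comp \<xi>]]
      by (simp add: linear_neg[OF A])
    then show "orthogonal \<xi> (v - adjoint A yb)"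
      by (simp add: orthogonal_def inner_diff_right adj inner_commute)
  qed
  then have "v - adjoint A yb \<in> T" using orthogonal_comp_self[OF \<open>subspace T\<close>] by simp
  then obtain q where q: "q \<in> S" "v - adjoint A yb = adjoint A q" by (auto simp: T_def)
  have v_eq: "adjoint A (yb + q) = v"
    using q(2) by (simp add: linear_add[OF adjoint_linear[OF A]] algebra_simps)
  define W where "W = range A + orthogonal_comp S"
  have "W = {a + b |a b. a \<in> range A \<and> b \<in> orthogonal_comp S}"
    by (auto simp: W_def set_plus_def)
  then have "subspace W"
    using A by (simp only:)
      (intro subspace_sums subspace_orthogonal_comp linear_subspace_image subspace_UNIV)
  \<comment> \<open>Dual form of nondegeneracy: a vector orthogonal to \<open>W\<close> lies in
    \<open>S\<close> and in the kernel of the adjoint, so it is zero and \<open>W\<close> is the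
    whole space.\<close>
  have "orthogonal_comp W \<subseteq> {0}"
  proof
    fix l assume l: "l \<in> orthogonal_comp W"
    have "0 \<in> orthogonal_comp S" by (rule subspace_0[OF subspace_orthogonal_comp])
    then have "A \<xi> \<in> W" for \<xi> unfolding W_def by (metis add.right_neutral rangeI set_plus_intro)
    then have "A \<xi> \<bullet> l = 0" for \<xi> using l by (auto simp: orthogonal_comp_def orthogonal_def)
    then have "adjoint A l = 0" using adj[of "adjoint A l" l] by simp
    moreover have "l \<in> S" unfolding in_S_iff
    proof
      fix s assume s: "s \<in> orthogonal_comp S"
      have "s \<in> W" unfolding W_def
        using set_plus_intro[OF rangeI[of A 0] s] by (simp add: linear_0[OF A])
      then show "l \<bullet> s = 0" using l by (auto simp: orthogonal_comp_def orthogonal_def inner_commute)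
    qed
    ultimately show "l \<in> {0}" using inj by blast
  qed
  then have "UNIV \<subseteq> W"
    using orthogonal_comp_self[OF \<open>subspace W\<close>] orthogonal_comp_anti_mono[of "orthogonal_comp W" "{0}"]
    by (simp add: orthogonal_comp_null)
  have "g (\<Psi> x) + (yb + q) \<bullet> (z' - \<Psi> x) \<le> g z'" if "z' \<in> D" for z'
  proof -
    define \<zeta> where "\<zeta> = z' - \<Psi> x"
    have "\<zeta> \<in> W" using \<open>UNIV \<subseteq> W\<close> by blast
    then obtain \<xi> s where \<xi>: "\<zeta> = A \<xi> + s" "s \<in> orthogonal_comp S"
      unfolding W_def by (auto elim!: set_plus_elim)
    have s: "A \<xi> - \<zeta> \<in> orthogonal_comp S"
      using \<xi> neg_orthogonal_comp by simp
    have "v \<bullet> \<xi> \<le> g (\<Psi> x + \<zeta>) - g (\<Psi> x) + yb \<bullet> (A \<xi> - \<zeta>)"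
      using that s by (intro ineq) (auto simp: \<zeta>_def)
    moreover have "v \<bullet> \<xi> = (yb + q) \<bullet> A \<xi>"
      using adj[of \<xi> "yb + q"] by (simp add: v_eq inner_commute)
    moreover have "q \<bullet> (A \<xi> - \<zeta>) = 0" using q(1) s in_S_iff by blast
    ultimately show ?thesis by (simp add: \<zeta>_def inner_add_left inner_diff_right)
  qed
  then have "yb + q \<in> convex_subdifferential \<theta> (\<Psi> x)" using x(1) by (simp add: subdifferential_iff)
  then show thesis using v_eq that by blast
qed

section \<open>From epigraph normals to limiting subgradients of the composition\<close>

lemma epigraph_iff: "(x, r) \<in> epigraph_ereal (\<lambda>x. \<theta> (\<Psi> x)) \<longleftrightarrow> \<Psi> x \<in> D \<and> g (\<Psi> x) \<le> r"
  by (simp add: epigraph_ereal_def \<theta>_eq)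

text \<open>The easy half of the chain rule: the subgradient inequality at \<open>\<Psi> x'\<close>
  and the first-order expansion of \<open>\<Psi>\<close> give a regular normal, and constant
  sequences make it a limiting one.\<close>

lemma limiting_subdifferential_compose_supset:
  fixes \<Psi> :: "'x::euclidean_space \<Rightarrow> 'z"
  assumes \<Psi>: "(\<Psi> has_derivative A) (at x)" and y: "y \<in> convex_subdifferential \<theta> (\<Psi> x)"
  shows "adjoint A y \<in> limiting_subdifferential (\<lambda>x. \<theta> (\<Psi> x)) x"
proof -
  have A: "linear A" using \<Psi> has_derivative_linear by blast
  have y': "\<Psi> x \<in> D" "\<And>z'. z' \<in> D \<Longrightarrow> g (\<Psi> x) + y \<bullet> (z' - \<Psi> x) \<le> g z'"
    using y by (auto simp: subdifferential_iff)
  let ?E = "epigraph_ereal (\<lambda>x. \<theta> (\<Psi> x))" and ?p = "(x, g (\<Psi> x))"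
  have "?p \<in> ?E" using y'(1) by (simp add: epigraph_iff)
  have "(adjoint A y, -1) \<in> regular_normal_cone ?p ?E"
  proof (rule regular_normal_coneI)
    fix e :: real assume "0 < e"
    define e' where "e' = e / (norm y + 1)"
    have "0 < e'" using \<open>0 < e\<close> by (simp add: e'_def add_nonneg_pos)
    then obtain d where "0 < d" and d: "\<And>x'. norm (x' - x) < d \<Longrightarrow>
        norm (\<Psi> x' - \<Psi> x - A (x' - x)) \<le> e' * norm (x' - x)"
      using \<Psi> unfolding has_derivative_at_alt by blast
    have "(adjoint A y, - 1) \<bullet> (p - ?p) \<le> e * norm (p - ?p)" if p: "p \<in> ?E" "dist p ?p < d" for p
    proof -
      obtain x' r where p_eq: "p = (x', r)" by fastforce
      have E: "\<Psi> x' \<in> D" "g (\<Psi> x') \<le> r" using p(1) by (simp_all add: p_eq epigraph_iff)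
      have "norm (x' - x) < d" using dist_fst_le[of p ?p] p(2) by (simp add: p_eq dist_norm)
      have "(adjoint A y, - 1) \<bullet> (p - ?p) = y \<bullet> A (x' - x) - (r - g (\<Psi> x))"
        using adjoint_works[OF A, of "x' - x" y] by (simp add: p_eq inner_commute)
      also have "\<dots> \<le> - (y \<bullet> (\<Psi> x' - \<Psi> x - A (x' - x)))"
        using y'(2)[OF E(1)] E(2) by (simp add: inner_diff_right)
      also have "\<dots> \<le> norm y * norm (\<Psi> x' - \<Psi> x - A (x' - x))"
        using norm_cauchy_schwarz[of "- y"] by simp
      also have "\<dots> \<le> norm y * (e' * norm (x' - x))"
        using d[OF \<open>norm (x' - x) < d\<close>] by (rule mult_left_mono) simp
      also have "\<dots> \<le> (norm y + 1) * (e' * norm (x' - x))"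
        using \<open>0 < e'\<close> by (intro mult_right_mono) auto
      also have "\<dots> = e * norm (x' - x)"
        using add_nonneg_pos[OF norm_ge_zero[of y] zero_less_one] by (simp add: e'_def)
      also have "\<dots> \<le> e * norm (p - ?p)"
        using \<open>0 < e\<close> norm_fst_le[of "x' - x" "r - g (\<Psi> x)"] by (simp add: p_eq)
      finally show ?thesis .
    qed
    then show "\<exists>d>0. \<forall>q\<in>?E. dist q ?p < d \<longrightarrow> (adjoint A y, - 1) \<bullet> (q - ?p) \<le> e * norm (q - ?p)"
      using \<open>0 < d\<close> by blast
  qed
  with \<open>?p \<in> ?E\<close> have "(adjoint A y, -1) \<in> limiting_normal_cone ?p ?E"
    by (intro limiting_normal_coneI[of _ _ "\<lambda>_. ?p" "\<lambda>_. (adjoint A y, -1)"]) auto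
  then show ?thesis using y'(1) by (auto simp: limiting_subdifferential_def \<theta>_eq)
qed

text \<open>Normals approximating (v, -1) have a last component merely near -1, hence the factor
  \<open>\<mu>\<close>. Its positivity excludes points above the graph, where the downward direction
  would be admissible. Testing only with graph points, whose distances are Lipschitz controlled by
  |x' - x|, yields a regular subgradient.\<close>

lemma regular_normal_epigraph_factorizes:
  fixes \<Psi> :: "'x::euclidean_space \<Rightarrow> 'z"
  assumes \<Psi>: "has_strict_derivative \<Psi> A x" and near: "dist (\<Psi> x) zb < \<rho>"
    and inj: "\<And>q. q \<in> S \<Longrightarrow> adjoint A q = 0 \<Longrightarrow> q = 0"
    and E: "(x, r) \<in> epigraph_ereal (\<lambda>x. \<theta> (\<Psi> x))" and "0 < \<mu>"
    and normal: "(v, - \<mu>) \<in> regular_normal_cone (x, r) (epigraph_ereal (\<lambda>x. \<theta> (\<Psi> x)))"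
  obtains y where "y \<in> convex_subdifferential \<theta> (\<Psi> x)" "\<mu> *\<^sub>R adjoint A y = v"
proof -
  let ?E = "epigraph_ereal (\<lambda>x. \<theta> (\<Psi> x))"
  have x: "\<Psi> x \<in> D" "g (\<Psi> x) \<le> r" using E by (simp_all add: epigraph_iff)
  have r: "r = g (\<Psi> x)"
  proof (rule ccontr)
    assume "r \<noteq> g (\<Psi> x)"
    then have "0 < r - g (\<Psi> x)" using x(2) by simp
    have "(v, - \<mu>) \<bullet> (0, - 1) \<le> 0"
      by (rule regular_normal_cone_direction[OF normal \<open>0 < r - g (\<Psi> x)\<close>])
         (use x in \<open>auto simp: epigraph_iff\<close>)
    then show False using \<open>0 < \<mu>\<close> by simp
  qed
  define u where "u = inverse \<mu> *\<^sub>R v"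
  have u: "(u, - 1) \<in> regular_normal_cone (x, r) ?E"
    using regular_normal_cone_scaleR[OF normal, of "inverse \<mu>"] \<open>0 < \<mu>\<close> by (simp add: u_def)
  obtain d1 L where "0 < d1" "0 < L" and L: "\<And>a b. dist a x < d1 \<Longrightarrow> dist b x < d1 \<Longrightarrow>
      norm (\<Psi> a - \<Psi> b) \<le> L * norm (a - b)"
    using has_strict_derivative_lipschitz[OF \<Psi>] by blast
  define N where "N = 1 + M * L"
  have "0 < N" using M_nonneg \<open>0 < L\<close> by (simp add: N_def add_pos_nonneg)
  have "\<exists>d>0. \<forall>x'. dist x' x < d \<longrightarrow> \<Psi> x' \<in> D \<longrightarrow>
      g (\<Psi> x) + u \<bullet> (x' - x) - e * norm (x' - x) \<le> g (\<Psi> x')" if "0 < e" for e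
  proof -
    have "0 < e / N" using \<open>0 < e\<close> \<open>0 < N\<close> by simp
    then obtain d where "0 < d" and d: "\<And>q. q \<in> ?E \<Longrightarrow> dist q (x, r) < d \<Longrightarrow>
        (u, - 1) \<bullet> (q - (x, r)) \<le> e / N * norm (q - (x, r))"
      using regular_normal_coneD[OF u] by blast
    have "g (\<Psi> x) + u \<bullet> (x' - x) - e * norm (x' - x) \<le> g (\<Psi> x')"
      if x': "dist x' x < min d1 (d / N)" "\<Psi> x' \<in> D" for x'
    proof -
      have "norm (g (\<Psi> x') - g (\<Psi> x)) \<le> M * norm (\<Psi> x' - \<Psi> x)" using lipschitz_g by simp
      also have "\<dots> \<le> M * (L * norm (x' - x))"
        using x'(1) \<open>0 < d1\<close> M_nonneg by (intro mult_left_mono L) auto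
      finally have "norm ((x', g (\<Psi> x')) - (x, r)) \<le> N * norm (x' - x)"
        using norm_Pair_le[of "x' - x" "g (\<Psi> x') - g (\<Psi> x)"]
        unfolding N_def diff_Pair r distrib_right by simp
      note le = this
      also have "\<dots> < d" using x'(1) \<open>0 < N\<close> by (simp add: dist_norm pos_less_divide_eq mult.commute)
      finally have "(u, - 1) \<bullet> ((x', g (\<Psi> x')) - (x, r)) \<le> e / N * norm ((x', g (\<Psi> x')) - (x, r))"
        using x'(2) by (intro d) (auto simp: epigraph_iff dist_norm)
      also have "\<dots> \<le> e / N * (N * norm (x' - x))"
        using le \<open>0 < e / N\<close> by (intro mult_left_mono) auto
      also have "\<dots> = e * norm (x' - x)" using \<open>0 < N\<close> by simp
      finally show ?thesis by (simp add: r)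
    qed
    then show ?thesis using \<open>0 < d1\<close> \<open>0 < d\<close> \<open>0 < N\<close>
      by (intro exI[of _ "min d1 (d / N)"]) auto
  qed
  then obtain y where "y \<in> convex_subdifferential \<theta> (\<Psi> x)" "adjoint A y = u"
    using regular_subgradient_factorizes[OF \<Psi> x(1) near inj] by blast
  then show thesis using that[of y] \<open>0 < \<mu>\<close> by (simp add: u_def)
qed

text \<open>The regular normals at nearby points have multipliers, which the uniform constant
  \<open>c\<close> keeps from escaping to infinity; a subsequence converges, and the closed graph
  identifies the limit.\<close>

lemma limiting_subdifferential_compose_subset:
  fixes \<Psi> :: "'x::euclidean_space \<Rightarrow> 'z" and A :: "'x \<Rightarrow> 'x \<Rightarrow>\<^sub>L 'z"
  assumes "open U" "x \<in> U"
    and \<Psi>: "\<And>x'. x' \<in> U \<Longrightarrow> (\<Psi> has_derivative A x') (at x')" and A: "continuous_on U A"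
    and near: "\<And>x'. x' \<in> U \<Longrightarrow> dist (\<Psi> x') zb < \<rho>"
    and "0 < c" and c: "\<And>x' q. x' \<in> U \<Longrightarrow> q \<in> S \<Longrightarrow> c * norm q \<le> norm (adjoint (A x') q)"
    and v: "v \<in> limiting_subdifferential (\<lambda>x. \<theta> (\<Psi> x)) x"
  obtains y where "y \<in> convex_subdifferential \<theta> (\<Psi> x)" "adjoint (A x) y = v"
proof -
  let ?E = "epigraph_ereal (\<lambda>x. \<theta> (\<Psi> x))"
  obtain r where "(v, - 1) \<in> limiting_normal_cone (x, r) ?E"
    using v by (auto simp: limiting_subdifferential_def)
  then obtain P V where P: "\<And>k. P k \<in> ?E" "P \<longlonglongrightarrow> (x, r)"
    and V: "\<And>k. V k \<in> regular_normal_cone (P k) ?E" "V \<longlonglongrightarrow> (v, - 1)"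
    using limiting_normal_coneE by metis
  define X where "X k = fst (P k)" for k
  define \<mu> where "\<mu> k = - snd (V k)" for k
  have X: "X \<longlonglongrightarrow> x" unfolding X_def using tendsto_fst[OF P(2)] by simp
  have \<mu>: "\<mu> \<longlonglongrightarrow> 1" unfolding \<mu>_def using tendsto_minus[OF tendsto_snd[OF V(2)]] by simp
  have fV: "(\<lambda>k. fst (V k)) \<longlonglongrightarrow> v" using tendsto_fst[OF V(2)] by simp
  have "\<forall>\<^sub>F k in sequentially. X k \<in> U \<and> 0 < \<mu> k"
    using topological_tendstoD[OF X \<open>open U\<close> \<open>x \<in> U\<close>] order_tendstoD(1)[OF \<mu> zero_less_one]
    by eventually_elim simp
  then obtain n where n: "\<And>k. X (k + n) \<in> U" "\<And>k. 0 < \<mu> (k + n)"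
    unfolding eventually_sequentially by (metis le_add2)
  have "\<exists>y. y \<in> convex_subdifferential \<theta> (\<Psi> (X (k + n))) \<and>
      \<mu> (k + n) *\<^sub>R adjoint (A (X (k + n))) y = fst (V (k + n))" for k
  proof -
    have inj: "q = 0" if "q \<in> S" "adjoint (A (X (k + n))) q = 0" for q
      using c[OF n(1)[of k] that(1)] that(2) \<open>0 < c\<close> by (simp add: mult_le_0_iff)
    have strict: "has_strict_derivative \<Psi> (A (X (k + n))) (X (k + n))"
      using \<open>open U\<close> n(1) \<Psi> A by (rule C1_imp_has_strict_derivative)
    have E: "(X (k + n), snd (P (k + n))) \<in> ?E"
      and normal: "(fst (V (k + n)), - \<mu> (k + n)) \<in> regular_normal_cone (X (k + n), snd (P (k + n))) ?E"
      using P(1)[of "k + n"] V(1)[of "k + n"] by (simp_all add: X_def \<mu>_def)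
    show ?thesis
      by (rule regular_normal_epigraph_factorizes[OF strict near[OF n(1)[of k]] inj E n(2)[of k] normal])
         blast+
  qed
  then obtain Y where Y: "\<And>k. Y k \<in> convex_subdifferential \<theta> (\<Psi> (X (k + n)))"
      "\<And>k. \<mu> (k + n) *\<^sub>R adjoint (A (X (k + n))) (Y k) = fst (V (k + n))"
    by metis
  define X' where "X' k = X (k + n)" for k
  have X': "X' \<longlonglongrightarrow> x" "\<And>k. X' k \<in> U"
    using LIMSEQ_ignore_initial_segment[OF X] n(1) by (simp_all add: X'_def [abs_def])
  have AX: "(\<lambda>k. A (X' k)) \<longlonglongrightarrow> A x"
    using continuous_on_tendsto_compose[OF A X'(1) \<open>x \<in> U\<close>] X'(2) by simp
  have "(\<lambda>k. inverse (\<mu> (k + n)) *\<^sub>R fst (V (k + n))) \<longlonglongrightarrow> inverse 1 *\<^sub>R v"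
    by (intro tendsto_intros LIMSEQ_ignore_initial_segment[OF \<mu>] LIMSEQ_ignore_initial_segment[OF fV]) simp
  moreover have "inverse (\<mu> (k + n)) *\<^sub>R fst (V (k + n)) = adjoint (A (X' k)) (Y k)" for k
    using n(2)[of k] by (simp add: X'_def flip: Y(2))
  ultimately have AY: "(\<lambda>k. adjoint (A (X' k)) (Y k)) \<longlonglongrightarrow> v" by simp
  \<comment> \<open>The lower bound \<open>c\<close> holds on \<open>S\<close> only, and it is
    \<open>Y k - yb\<close>, not \<open>Y k\<close>, that is known to lie in
    \<open>S\<close>.\<close>
  have "(\<lambda>k. adjoint (A (X' k)) (Y k - yb)) \<longlonglongrightarrow> v - adjoint (A x) yb"
    unfolding bounded_bilinear.diff_right[OF bounded_bilinear_adjoint_blinfun]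
    by (intro tendsto_diff AY bounded_bilinear.tendsto[OF bounded_bilinear_adjoint_blinfun AX tendsto_const])
  then have "Bseq (\<lambda>k. adjoint (A (X' k)) (Y k - yb))"
    by (intro convergent_imp_Bseq convergentI)
  then obtain K where K: "\<And>k. norm (adjoint (A (X' k)) (Y k - yb)) \<le> K"
    unfolding Bseq_def by blast
  have "Y k \<in> cball yb (K / c)" for k
  proof -
    have "Y k - yb \<in> S" using subgradient_diff_in_S[OF Y(1) near] X'(2) by (simp add: X'_def)
    then have "c * norm (Y k - yb) \<le> K" using c[OF X'(2)] K order_trans by blast
    then show ?thesis using \<open>0 < c\<close>
      by (simp add: dist_norm norm_minus_commute pos_le_divide_eq mult.commute)
  qed
  then obtain y s where s: "strict_mono s" "(Y \<circ> s) \<longlonglongrightarrow> y"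
    using compact_cball[of yb "K / c"] unfolding compact_def by blast
  have X's: "(\<lambda>k. X' (s k)) \<longlonglongrightarrow> x"
    using LIMSEQ_subseq_LIMSEQ[OF X'(1) s(1)] by (simp add: o_def)
  have Ys: "(\<lambda>k. Y (s k)) \<longlonglongrightarrow> y" using s(2) by (simp add: o_def)
  have "isCont \<Psi> x" using \<Psi>[OF \<open>x \<in> U\<close>] by (rule has_derivative_continuous)
  then have "(\<lambda>k. (\<Psi> (X' (s k)), Y (s k))) \<longlonglongrightarrow> (\<Psi> x, y)"
    using X's Ys by (intro tendsto_Pair isCont_tendsto_compose[of x \<Psi>])
  moreover have "(\<Psi> (X' (s k)), Y (s k)) \<in> gph (convex_subdifferential \<theta>)" for k
    using Y(1) by (simp add: gph_def X'_def)
  ultimately have "(\<Psi> x, y) \<in> gph (convex_subdifferential \<theta>)"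
    by (rule closed_sequentially[OF closed_graph, rotated])
  moreover have "adjoint (A x) y = v"
  proof -
    have "(\<lambda>k. A (X' (s k))) \<longlonglongrightarrow> A x"
      using LIMSEQ_subseq_LIMSEQ[OF AX s(1)] by (simp add: o_def)
    then have "(\<lambda>k. adjoint (A (X' (s k))) (Y (s k))) \<longlonglongrightarrow> adjoint (A x) y"
      using Ys by (rule bounded_bilinear.tendsto[OF bounded_bilinear_adjoint_blinfun])
    moreover have "(\<lambda>k. adjoint (A (X' (s k))) (Y (s k))) \<longlonglongrightarrow> v"
      using LIMSEQ_subseq_LIMSEQ[OF AY s(1)] by (simp add: o_def)
    ultimately show ?thesis by (rule LIMSEQ_unique)
  qed
  ultimately show thesis using that[of y] by (simp add: gph_def)
qed

end

section \<open>Convex piecewise linear functions are partly affine\<close>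

text \<open>The subgradient \<open>y\<close> makes the affine hull nonempty, so the definite
  description is well defined; the translation cancels in differences.\<close>

lemma parallel_subspace_subdifferential:
  fixes \<theta> :: "'z::euclidean_space \<Rightarrow> ereal"
  assumes "y \<in> convex_subdifferential \<theta> z"
  shows "subspace (parallel_subspace_subdifferential \<theta> z)"
    and "\<And>y1 y2. y1 \<in> convex_subdifferential \<theta> z \<Longrightarrow> y2 \<in> convex_subdifferential \<theta> z \<Longrightarrow>
           y1 - y2 \<in> parallel_subspace_subdifferential \<theta> z"
proof -
  define L where "L = parallel_subspace_subdifferential \<theta> z"
  have nonempty: "affine hull convex_subdifferential \<theta> z \<noteq> {}" using assms by auto
  have L: "subspace L \<and> affine_parallel (affine hull convex_subdifferential \<theta> z) L"
    unfolding L_def parallel_subspace_subdifferential_def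
    by (rule theI'[OF affine_parallel_subspace[OF affine_affine_hull nonempty]])
  then show "subspace (parallel_subspace_subdifferential \<theta> z)" by (simp add: L_def)
  obtain a where a: "L = (+) a ` (affine hull convex_subdifferential \<theta> z)"
    using L by (auto simp: affine_parallel_def)
  fix y1 y2 assume "y1 \<in> convex_subdifferential \<theta> z" "y2 \<in> convex_subdifferential \<theta> z"
  then have "a + y1 \<in> L" "a + y2 \<in> L" unfolding a by (simp_all add: hull_inc)
  then have "(a + y1) - (a + y2) \<in> L" using L subspace_diff by blast
  then show "y1 - y2 \<in> parallel_subspace_subdifferential \<theta> z" by (simp add: L_def)
qed

text \<open>Near \<open>zb\<close> only pieces active at \<open>zb\<close> attain the maximum.
  Orthogonally to \<open>S\<close> all of these grow at the common rate given by \<open>yb\<close>,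
  and the active constraints keep their values.\<close>

lemma convex_piecewise_linear_partly_affine:
  fixes \<theta> :: "'z::euclidean_space \<Rightarrow> ereal"
  assumes "convex_piecewise_linear \<theta>" and yb: "yb \<in> convex_subdifferential \<theta> zb"
  obtains D g M \<rho> where
    "partly_affine \<theta> D g M (parallel_subspace_subdifferential \<theta> zb) zb yb \<rho>"
proof -
  obtain l p :: nat and a d :: "nat \<Rightarrow> 'z" and \<alpha> \<beta> :: "nat \<Rightarrow> real" where "1 \<le> l"
    and dom: "effective_domain \<theta> = {z. \<forall>i\<in>{1..p}. d i \<bullet> z \<le> \<beta> i}"
    and fin: "\<And>z. z \<in> effective_domain \<theta> \<Longrightarrow> \<theta> z = ereal (Max ((\<lambda>i. a i \<bullet> z - \<alpha> i) ` {1..l}))"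
    and inf: "\<And>z. z \<notin> effective_domain \<theta> \<Longrightarrow> \<theta> z = \<infinity>"
    using assms(1) unfolding convex_piecewise_linear_def by blast
  define D where "D = effective_domain \<theta>"
  define g where "g z = Max ((\<lambda>i. a i \<bullet> z - \<alpha> i) ` {1..l})" for z
  have D: "D = {z. \<forall>i\<in>{1..p}. d i \<bullet> z \<le> \<beta> i}" using dom by (simp add: D_def)
  have \<theta>_eq: "\<theta> z = (if z \<in> D then ereal (g z) else \<infinity>)" for z
    using fin inf by (simp add: D_def g_def)
  have g_ge: "a i \<bullet> z - \<alpha> i \<le> g z" if "i \<in> {1..l}" for i z
    unfolding g_def using that by (intro Max_ge) auto
  have g_attained: "\<exists>i\<in>{1..l}. g z = a i \<bullet> z - \<alpha> i" for z
  proof -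
    have "g z \<in> (\<lambda>i. a i \<bullet> z - \<alpha> i) ` {1..l}"
      unfolding g_def using \<open>1 \<le> l\<close> by (intro Max_in) auto
    then show ?thesis by blast
  qed
  have D_Inter: "D = (\<Inter>i\<in>{1..p}. {z. d i \<bullet> z \<le> \<beta> i})" unfolding D by blast
  have "closed D" "convex D"
    unfolding D_Inter by (auto intro!: closed_INT convex_INT closed_halfspace_le convex_halfspace_le)
  have "convex_on D g"
  proof (rule convex_onI)
    fix t x y assume t: "0 < t" "t < (1::real)" and "x \<in> D" "y \<in> D"
    obtain i where i: "i \<in> {1..l}" "g ((1 - t) *\<^sub>R x + t *\<^sub>R y) = a i \<bullet> ((1 - t) *\<^sub>R x + t *\<^sub>R y) - \<alpha> i"
      using g_attained by blast
    have "g ((1 - t) *\<^sub>R x + t *\<^sub>R y) = (1 - t) * (a i \<bullet> x - \<alpha> i) + t * (a i \<bullet> y - \<alpha> i)"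
      unfolding i(2) by (simp add: inner_add_right algebra_simps)
    also have "\<dots> \<le> (1 - t) * g x + t * g y"
      using t g_ge[OF i(1)] by (intro add_mono mult_left_mono) auto
    finally show "g ((1 - t) *\<^sub>R x + t *\<^sub>R y) \<le> (1 - t) * g x + t * g y" .
  qed fact
  define M where "M = (\<Sum>i\<in>{1..l}. norm (a i))"
  have g_le: "g x - g y \<le> M * norm (x - y)" for x y
  proof -
    obtain i where i: "i \<in> {1..l}" "g x = a i \<bullet> x - \<alpha> i" using g_attained by blast
    have "g x - g y \<le> a i \<bullet> (x - y)" using g_ge[OF i(1), of y] i(2) by (simp add: inner_diff_right)
    also have "\<dots> \<le> norm (a i) * norm (x - y)" by (rule norm_cauchy_schwarz)
    also have "\<dots> \<le> M * norm (x - y)"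
      unfolding M_def using i(1) by (intro mult_right_mono member_le_sum) auto
    finally show ?thesis .
  qed
  have lipschitz: "\<bar>g x - g y\<bar> \<le> M * norm (x - y)" for x y
    using g_le[of x y] g_le[of y x] by (simp add: norm_minus_commute abs_le_iff)
  have sub: "y \<in> convex_subdifferential \<theta> z \<longleftrightarrow> z \<in> D \<and> (\<forall>z'\<in>D. g z + y \<bullet> (z' - z) \<le> g z')" for y z
    by (auto simp: convex_subdifferential_def \<theta>_eq)
  define S where "S = parallel_subspace_subdifferential \<theta> zb"
  have "subspace S" unfolding S_def by (rule parallel_subspace_subdifferential(1)[OF yb])
  have "zb \<in> D" using yb by (simp add: sub)
  define K where "K = {i\<in>{1..l}. a i \<bullet> zb - \<alpha> i = g zb}"
  define I where "I = {i\<in>{1..p}. d i \<bullet> zb = \<beta> i}"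
  obtain k where k: "k \<in> K" using g_attained[of zb] by (auto simp: K_def)
  have aK: "a i \<in> convex_subdifferential \<theta> zb" if "i \<in> K" for i
    using that g_ge[of i] \<open>zb \<in> D\<close> by (auto simp: sub K_def inner_diff_right) (smt (verit))
  \<comment> \<open>Hence every \<open>s\<close> orthogonal to \<open>S\<close> is orthogonal to the \<open>d j\<close> active at \<open>zb\<close> and to the
    differences of the \<open>a i\<close> active at \<open>zb\<close>.\<close>
  have adI: "a k + d j \<in> convex_subdifferential \<theta> zb" if "j \<in> I" for j
  proof -
    have "g zb + (a k + d j) \<bullet> (z' - zb) \<le> g z'" if "z' \<in> D" for z'
    proof -
      have "d j \<bullet> (z' - zb) \<le> 0"
        using \<open>j \<in> I\<close> that by (auto simp: I_def D inner_diff_right)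
      then show ?thesis
        using aK[OF k] that by (auto simp: sub inner_add_left)
    qed
    then show ?thesis using \<open>zb \<in> D\<close> by (simp add: sub)
  qed
  \<comment> \<open>A neighbourhood of \<open>zb\<close> given by finitely many strict inequalities:
    pieces inactive at \<open>zb\<close> stay below the active piece \<open>k\<close>, inactive
    constraints stay strict.\<close>
  define W where "W = (\<Inter>i\<in>{1..l} - K. {z. a i \<bullet> z - \<alpha> i < a k \<bullet> z - \<alpha> k})
      \<inter> (\<Inter>j\<in>{1..p} - I. {z. d j \<bullet> z < \<beta> j})"
  have "open W" unfolding W_def
    by (intro open_Int open_INT finite_Diff finite_atLeastAtMost ballI open_Collect_less continuous_intros)
  moreover have "zb \<in> W"
  proof -
    have "a i \<bullet> zb - \<alpha> i < a k \<bullet> zb - \<alpha> k" if "i \<in> {1..l} - K" for i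
      using that g_ge[of i zb] k by (auto simp: K_def)
    moreover have "d j \<bullet> zb < \<beta> j" if "j \<in> {1..p} - I" for j
      using that \<open>zb \<in> D\<close> by (force simp: I_def D)
    ultimately show ?thesis by (auto simp: W_def)
  qed
  ultimately obtain e where "0 < e" "ball zb e \<subseteq> W" using open_contains_ball by blast
  have g_on_W: "\<exists>i\<in>K. g z = a i \<bullet> z - \<alpha> i" if "z \<in> W" for z
  proof -
    obtain i where i: "i \<in> {1..l}" "g z = a i \<bullet> z - \<alpha> i" using g_attained by blast
    have "i \<in> K"
    proof (rule ccontr)
      assume "i \<notin> K"
      then have "a i \<bullet> z - \<alpha> i < a k \<bullet> z - \<alpha> k" using that i(1) by (auto simp: W_def)
      then show False using g_ge[of k z] k i(2) by (auto simp: K_def)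
    qed
    then show ?thesis using i(2) by blast
  qed
  \<comment> \<open>With half the radius for each of the two distances, both \<open>z\<close> and
    \<open>z + s\<close> stay in \<open>W\<close>.\<close>
  have shift: "z + s \<in> D \<and> g (z + s) = g z + yb \<bullet> s"
    if "z \<in> D" "dist z zb < e / 2" and s: "s \<in> orthogonal_comp S" and "norm s < e / 2" for z s
  proof -
    have perp: "(y1 - y2) \<bullet> s = 0"
      if "y1 \<in> convex_subdifferential \<theta> zb" "y2 \<in> convex_subdifferential \<theta> zb" for y1 y2
      using parallel_subspace_subdifferential(2)[OF yb that] s
      by (auto simp: S_def orthogonal_comp_def orthogonal_def)
    have as: "a i \<bullet> s = yb \<bullet> s" if "i \<in> K" for i
      using perp[OF aK[OF that] yb] by (simp add: inner_diff_left)
    have ds: "d j \<bullet> s = 0" if "j \<in> I" for j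
      using perp[OF adI[OF that] aK[OF k]] by (simp add: inner_diff_left inner_add_left)
    have "dist (z + s) zb < e"
      using norm_triangle_ineq[of "z - zb" s] that by (simp add: dist_norm add_diff_eq diff_add_eq)
    then have W: "z \<in> W" "z + s \<in> W"
      using \<open>ball zb e \<subseteq> W\<close> that(2) \<open>0 < e\<close> by (auto simp: dist_commute)
    have "d j \<bullet> (z + s) \<le> \<beta> j" if "j \<in> {1..p}" for j
    proof (cases "j \<in> I")
      case True
      then show ?thesis using ds[OF True] \<open>z \<in> D\<close> that by (simp add: inner_add_right D)
    next
      case False
      then show ?thesis using W(2) that by (auto simp: W_def intro: less_imp_le)
    qed
    moreover have "g (z + s) = g z + yb \<bullet> s"
    proof (rule antisym)
      obtain i where i: "i \<in> K" "g (z + s) = a i \<bullet> (z + s) - \<alpha> i" using g_on_W[OF W(2)] by blast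
      then show "g (z + s) \<le> g z + yb \<bullet> s"
        using g_ge[of i z] as[OF i(1)] by (simp add: K_def inner_add_right)
      obtain j where j: "j \<in> K" "g z = a j \<bullet> z - \<alpha> j" using g_on_W[OF W(1)] by blast
      then show "g z + yb \<bullet> s \<le> g (z + s)"
        using g_ge[of j "z + s"] as[OF j(1)] by (simp add: K_def inner_add_right)
    qed
    ultimately show ?thesis by (simp add: D)
  qed
  have "partly_affine \<theta> D g M S zb yb (e / 2)"
    by unfold_locales (use \<theta>_eq \<open>closed D\<close> \<open>convex D\<close> \<open>convex_on D g\<close> lipschitz \<open>subspace S\<close> yb \<open>0 < e\<close> shift in auto)
  then show thesis using that by (simp add: S_def)
qed

section \<open>Partial derivatives\<close>

lemma has_derivative_partial_fst:
  assumes "(F has_derivative F') (at (x, w))"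
  shows "((\<lambda>x'. F (x', w)) has_derivative (\<lambda>h. F' (h, 0))) (at x)"
proof -
  have "((\<lambda>x'. (x', w)) has_derivative (\<lambda>h. (h, 0))) (at x)"
    by (auto intro!: derivative_eq_intros)
  from has_derivative_compose[OF this assms] show ?thesis .
qed

lemma deriv_x_eq:
  "(F has_derivative F') (at (x, w)) \<Longrightarrow> deriv_x F x w = (\<lambda>h. F' (h, 0))"
  unfolding deriv_x_def by (rule frechet_derivative_at[OF has_derivative_partial_fst, symmetric])

lemma gradient_eq:
  assumes "GDERIV \<phi> x :> g"
  shows "gradient \<phi> x = g"
  unfolding gradient_def
proof (rule the_equality[where P = "\<lambda>g. GDERIV \<phi> x :> g", OF assms])
  fix g' assume "GDERIV \<phi> x :> g'"
  with assms have "(\<lambda>h. h \<bullet> g') = (\<lambda>h. h \<bullet> g)"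
    unfolding gderiv_def by (blast intro: has_derivative_unique)
  then show "g' = g" by (metis vector_eq_ldot)
qed

text \<open>\<open>adjoint \<phi>' 1\<close> represents the derivative, so the gradient in the
  definite description exists.\<close>

lemma gradient_inner:
  fixes \<phi> :: "'a::euclidean_space \<Rightarrow> real"
  assumes "(\<phi> has_derivative \<phi>') (at x)"
  shows "gradient \<phi> x \<bullet> h = \<phi>' h"
proof -
  have lin: "linear \<phi>'" using assms has_derivative_linear by blast
  have "GDERIV \<phi> x :> adjoint \<phi>' 1"
    using assms adjoint_works[OF lin, of _ 1] by (simp add: gderiv_def)
  then show ?thesis using adjoint_works[OF lin, of h 1] by (simp add: gradient_eq inner_commute)
qed

text \<open>Puts the nested gradients into the form in which the second derivative enters
  \<open>H'\<close> in the main proof. The inner gradient is identified on the whole open slice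
  \<open>V\<close>, since differentiating it requires a neighbourhood.\<close>

lemma hess_xx_inner:
  fixes \<Phi> :: "'x::euclidean_space \<times> 'w::euclidean_space \<Rightarrow> 'z::euclidean_space"
    and F' :: "'x \<times> 'w \<Rightarrow> ('x \<times> 'w) \<Rightarrow>\<^sub>L 'z" and F'' :: "'x \<times> 'w \<Rightarrow> ('x \<times> 'w) \<Rightarrow>\<^sub>L 'z"
  assumes "open U" "(x, w) \<in> U" and \<Phi>: "\<And>q. q \<in> U \<Longrightarrow> (\<Phi> has_derivative blinfun_apply (F' q)) (at q)"
    and F': "(F' has_derivative F'') (at (x, w))"
  shows "hess_xx (\<lambda>p. y \<bullet> \<Phi> p) x w u \<bullet> h = y \<bullet> blinfun_apply (F'' (h, 0)) (u, 0)"
proof -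
  define V where "V = (\<lambda>x'. (x', w)) -` U"
  have "open V"
    unfolding V_def using \<open>open U\<close> by (intro open_vimage) (auto intro: continuous_intros)
  have grad: "gradient (\<lambda>\<xi>. y \<bullet> \<Phi> (\<xi>, w)) x' \<bullet> u = y \<bullet> blinfun_apply (F' (x', w)) (u, 0)" if "x' \<in> V" for x'
  proof (rule gradient_inner)
    have "((\<lambda>\<xi>. \<Phi> (\<xi>, w)) has_derivative (\<lambda>h. blinfun_apply (F' (x', w)) (h, 0))) (at x')"
      using that by (intro has_derivative_partial_fst \<Phi>) (simp add: V_def)
    then show "((\<lambda>\<xi>. y \<bullet> \<Phi> (\<xi>, w)) has_derivative (\<lambda>h. y \<bullet> blinfun_apply (F' (x', w)) (h, 0))) (at x')"
      by (rule has_derivative_inner_right)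
  qed
  have "((\<lambda>x'. F' (x', w)) has_derivative (\<lambda>h. F'' (h, 0))) (at x)"
    by (rule has_derivative_partial_fst[OF F'])
  then have "((\<lambda>x'. y \<bullet> blinfun_apply (F' (x', w)) (u, 0)) has_derivative (\<lambda>h. y \<bullet> blinfun_apply (F'' (h, 0)) (u, 0))) (at x)"
    by (intro has_derivative_inner_right bounded_linear.has_derivative[OF blinfun.bounded_linear_left])
  then have "((\<lambda>x'. gradient (\<lambda>\<xi>. y \<bullet> \<Phi> (\<xi>, w)) x' \<bullet> u) has_derivative (\<lambda>h. y \<bullet> blinfun_apply (F'' (h, 0)) (u, 0))) (at x)"
    by (rule has_derivative_transform_within_open[OF _ \<open>open V\<close>])
       (use \<open>(x, w) \<in> U\<close> grad in \<open>auto simp: V_def\<close>)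
  then show ?thesis unfolding hess_xx_def by (rule gradient_inner)
qed

text \<open>Testing only with points that share the first component leaves the normal inequality of
  the second factor.\<close>

lemma limiting_normal_cone_Times_snd:
  assumes "(a, b) \<in> limiting_normal_cone (p, q) (P \<times> Q)"
  shows "b \<in> limiting_normal_cone q Q"
proof -
  obtain X V where X: "\<And>k. X k \<in> P \<times> Q" "X \<longlonglongrightarrow> (p, q)"
    and V: "\<And>k. V k \<in> regular_normal_cone (X k) (P \<times> Q)" "V \<longlonglongrightarrow> (a, b)" and "(p, q) \<in> P \<times> Q"
    using limiting_normal_coneE[OF assms] by metis
  have "snd (V k) \<in> regular_normal_cone (snd (X k)) Q" for k
  proof (rule regular_normal_coneI)
    fix e :: real assume "0 < e"
    then obtain d where "0 < d" and d: "\<And>s. s \<in> P \<times> Q \<Longrightarrow> dist s (X k) < d \<Longrightarrow>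
        V k \<bullet> (s - X k) \<le> e * norm (s - X k)"
      using regular_normal_coneD[OF V(1)] by blast
    have "snd (V k) \<bullet> (s - snd (X k)) \<le> e * norm (s - snd (X k))"
      if "s \<in> Q" "dist s (snd (X k)) < d" for s
      using d[of "(fst (X k), s)"] X(1)[of k] that
      by (auto simp: mem_Times_iff dist_prod_def inner_prod_def norm_prod_def dist_norm)
    then show "\<exists>d>0. \<forall>s\<in>Q. dist s (snd (X k)) < d \<longrightarrow>
        snd (V k) \<bullet> (s - snd (X k)) \<le> e * norm (s - snd (X k))"
      using \<open>0 < d\<close> by blast
  qed
  moreover have "(\<lambda>k. snd (X k)) \<longlonglongrightarrow> q" "(\<lambda>k. snd (V k)) \<longlonglongrightarrow> b"
    using tendsto_snd[OF X(2)] tendsto_snd[OF V(2)] by simp_all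
  ultimately show ?thesis
    using \<open>(p, q) \<in> P \<times> Q\<close> X(1)
    by (intro limiting_normal_coneI[of _ _ "\<lambda>k. snd (X k)" "\<lambda>k. snd (V k)"]) (auto simp: mem_Times_iff)
qed

section \<open>The parametric system near the reference point\<close>

lemma lipschitz_likeI:
  assumes "0 < d" "0 < L"
    and "\<And>w1 w2 x1. dist w1 w < d \<Longrightarrow> dist w2 w < d \<Longrightarrow> dist x1 x < d \<Longrightarrow> x1 \<in> S w1 \<Longrightarrow>
        \<exists>x2 \<in> S w2. norm (x1 - x2) \<le> L * norm (w1 - w2)"
  shows "lipschitz_like S w x"
  unfolding lipschitz_like_def
proof (intro exI conjI ballI subsetI)
  fix w1 w2 x1 assume "w1 \<in> ball w d" "w2 \<in> ball w d" "x1 \<in> S w1 \<inter> ball x d"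
  then obtain x2 where x2: "x2 \<in> S w2" "norm (x1 - x2) \<le> L * norm (w1 - w2)"
    using assms(3)[of w1 w2 x1] by (auto simp: dist_commute)
  define t where "t = L * norm (w1 - w2)"
  have "0 \<le> t" using \<open>0 < L\<close> by (simp add: t_def)
  \<comment> \<open>If \<open>t = 0\<close> then \<open>x1 = x2\<close>, and
    \<open>inverse 0 = 0\<close> makes \<open>b\<close> zero.\<close>
  define b where "b = inverse t *\<^sub>R (x1 - x2)"
  have "norm b \<le> 1"
    using x2(2) \<open>0 \<le> t\<close> by (cases "t = 0") (auto simp: b_def t_def[symmetric] divide_simps)
  moreover have "x1 = x2 + t *\<^sub>R b"
    using x2(2) by (cases "t = 0") (auto simp: b_def t_def[symmetric])
  ultimately show "x1 \<in> {x' + (L * norm (w1 - w2)) *\<^sub>R b |x' b. x' \<in> S w2 \<and> b \<in> cball 0 1}"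
    using x2(1) by (auto simp: t_def)
qed (use assms in auto)

text \<open>An injective linear map on a subspace of finite dimension is bounded below; by
  continuity of \<open>G\<close> at most half of that bound is lost nearby.\<close>

lemma (in partly_affine) uniform_injectivity:
  fixes G :: "'q::metric_space \<Rightarrow> 'x::euclidean_space \<Rightarrow>\<^sub>L 'z"
  assumes G: "isCont G p" and inj: "\<And>q. q \<in> S \<Longrightarrow> adjoint (G p) q = 0 \<Longrightarrow> q = 0"
  obtains c r where "0 < c" "0 < r"
    "\<And>p' q. dist p' p < r \<Longrightarrow> q \<in> S \<Longrightarrow> c * norm q \<le> norm (adjoint (G p') q)"
proof -
  interpret adj: bounded_bilinear "\<lambda>(T::'x \<Rightarrow>\<^sub>L 'z) y. adjoint T y"
    by (rule bounded_bilinear_adjoint_blinfun)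
  obtain e where "0 < e" and e: "\<And>q. q \<in> S \<Longrightarrow> e * norm q \<le> norm (adjoint (G p) q)"
    using injective_imp_isometric[OF closed_subspace[OF subspace_S] subspace_S adj.bounded_linear_right[of "G p"]]
      inj by blast
  obtain K where "0 < K" and K: "\<And>T y. norm (adjoint (blinfun_apply T) y) \<le> norm (T :: 'x \<Rightarrow>\<^sub>L 'z) * norm y * K"
    using adj.pos_bounded by blast
  have "0 < e / (2 * K)" using \<open>0 < e\<close> \<open>0 < K\<close> by simp
  then obtain r where "0 < r" and r: "\<And>p'. dist p' p < r \<Longrightarrow> dist (G p') (G p) < e / (2 * K)"
    using G unfolding continuous_at_eps_delta by blast
  have "e / 2 * norm q \<le> norm (adjoint (G p') q)" if "dist p' p < r" "q \<in> S" for p' q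
  proof -
    have "norm (adjoint (G p) q) \<le> norm (adjoint (G p') q) + norm (adjoint (G p' - G p) q)"
      using norm_triangle_ineq4[of "adjoint (G p') q" "adjoint (G p' - G p) q"]
      by (simp only: adj.diff_left diff_diff_eq2 add_diff_cancel_left')
    moreover have "norm (adjoint (G p' - G p) q) \<le> e / (2 * K) * norm q * K"
      using r[OF that(1)] \<open>0 < K\<close>
      by (intro order_trans[OF K] mult_right_mono) (auto simp: dist_norm)
    ultimately show ?thesis using e[OF that(2)] \<open>0 < K\<close> by simp
  qed
  then show thesis using that[of "e / 2" r] \<open>0 < e\<close> \<open>0 < r\<close> by simp
qed

text \<open>Both halves of the chain rule for the slice at fixed \<open>w\<close>. The hypotheses
  range over an open set because limiting subgradients see nearby points.\<close>

lemma (in partly_affine) mem_solution_map_iff: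
  fixes \<Phi> :: "'x::euclidean_space \<times> 'w::real_normed_vector \<Rightarrow> 'z" and G :: "'x \<times> 'w \<Rightarrow> 'x \<Rightarrow>\<^sub>L 'z"
  assumes "open V" "x \<in> V"
    and \<Phi>: "\<And>x'. x' \<in> V \<Longrightarrow> ((\<lambda>x'. \<Phi> (x', w)) has_derivative blinfun_apply (G (x', w))) (at x')"
    and G: "continuous_on V (\<lambda>x'. G (x', w))"
    and near: "\<And>x'. x' \<in> V \<Longrightarrow> dist (\<Phi> (x', w)) zb < \<rho>"
    and "0 < c" and c: "\<And>x' q. x' \<in> V \<Longrightarrow> q \<in> S \<Longrightarrow> c * norm q \<le> norm (adjoint (G (x', w)) q)"
  shows "x \<in> solution_map f \<theta> \<Phi> w \<longleftrightarrow>
    (\<exists>y \<in> convex_subdifferential \<theta> (\<Phi> (x, w)). f (x, w) + adjoint (G (x, w)) y = 0)"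
proof
  assume "x \<in> solution_map f \<theta> \<Phi> w"
  then obtain v where v: "v \<in> limiting_subdifferential (\<lambda>x'. \<theta> (\<Phi> (x', w))) x" "f (x, w) + v = 0"
    by (auto simp: solution_map_def)
  obtain y where "y \<in> convex_subdifferential \<theta> (\<Phi> (x, w))" "adjoint (G (x, w)) y = v"
    by (rule limiting_subdifferential_compose_subset[OF \<open>open V\<close> \<open>x \<in> V\<close> \<Phi> G near \<open>0 < c\<close> c v(1)])
  then show "\<exists>y \<in> convex_subdifferential \<theta> (\<Phi> (x, w)). f (x, w) + adjoint (G (x, w)) y = 0"
    using v(2) by blast
next
  assume "\<exists>y \<in> convex_subdifferential \<theta> (\<Phi> (x, w)). f (x, w) + adjoint (G (x, w)) y = 0"
  then obtain y where y: "y \<in> convex_subdifferential \<theta> (\<Phi> (x, w))" "f (x, w) + adjoint (G (x, w)) y = 0"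
    by blast
  have "adjoint (G (x, w)) y \<in> limiting_subdifferential (\<lambda>x'. \<theta> (\<Phi> (x', w))) x"
    by (rule limiting_subdifferential_compose_supset[OF \<Phi>[OF \<open>x \<in> V\<close>] y(1)])
  then show "x \<in> solution_map f \<theta> \<Phi> w"
    unfolding solution_map_def using y(2) by (intro CollectI image_eqI) auto
qed

theorem theorem4p2:
  fixes \<theta> :: "real ^ 'm \<Rightarrow> ereal"
    and \<Phi> :: "(real ^ 'n) \<times> (real ^ 'd) \<Rightarrow> real ^ 'm"
    and f :: "(real ^ 'n) \<times> (real ^ 'd) \<Rightarrow> real ^ 'n"
    and x :: "real ^ 'n" and w :: "real ^ 'd" and v :: "real ^ 'n" and z y :: "real ^ 'm"
  assumes "convex_piecewise_linear \<theta>"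
    and "C2_around \<Phi> (x, w)"
    and "(w, x) \<in> gph (solution_map f \<theta> \<Phi>)"
    and "strictly_differentiable_at f (x, w)"
    and "v = - f (x, w)"
    and "z = \<Phi> (x, w)"
    and standing: "0 \<in> affine hull (convex_subdifferential \<theta> z)"
    and "nondegenerate \<theta> \<Phi> x w"
    and "y \<in> convex_subdifferential \<theta> z"
    and "adjoint (deriv_x \<Phi> x w) y = v"
    and "\<forall>u. 0 \<in> (\<lambda>s. adjoint_deriv f x w u + s) ` second_order_set \<theta> \<Phi> x w y u \<longrightarrow> u = 0"
    and "{a. \<exists>u. deriv_x \<Phi> x w u \<in> dom_second_order_subdifferential \<theta> z y \<and>
               (- adjoint (deriv_x f x w) u, a - adjoint (deriv_w f x w) u)
                 \<in> second_order_set \<theta> \<Phi> x w y u} = {0}"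
  shows "lipschitz_like (solution_map f \<theta> \<Phi>) w x"
proof -
  define S where "S = parallel_subspace_subdifferential \<theta> z"
  obtain D g M \<rho> where "partly_affine \<theta> D g M S z y \<rho>"
    using convex_piecewise_linear_partly_affine[OF assms(1,9)] unfolding S_def by blast
  then interpret partly_affine \<theta> D g M S z y \<rho> .
  interpret adj: bounded_bilinear "\<lambda>(T::(real^'n) \<Rightarrow>\<^sub>L (real^'m)) y. adjoint T y"
    by (rule bounded_bilinear_adjoint_blinfun)
  obtain U and F' :: "(real^'n) \<times> (real^'d) \<Rightarrow> ((real^'n) \<times> (real^'d)) \<Rightarrow>\<^sub>L (real^'m)"
    and F'' :: "(real^'n) \<times> (real^'d) \<Rightarrow> ((real^'n) \<times> (real^'d)) \<Rightarrow>\<^sub>L (((real^'n) \<times> (real^'d)) \<Rightarrow>\<^sub>L (real^'m))"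
    where U: "open U" "(x, w) \<in> U"
      and \<Phi>: "\<And>q. q \<in> U \<Longrightarrow> (\<Phi> has_derivative blinfun_apply (F' q)) (at q)"
      and F': "\<And>q. q \<in> U \<Longrightarrow> (F' has_derivative blinfun_apply (F'' q)) (at q)"
      and F'': "continuous_on U F''"
    using assms(2) unfolding C2_around_def by blast
  \<comment> \<open>Composition with this embedding turns \<open>F'\<close> into the partial
    derivative in \<open>x\<close> as a bounded operator, so that it inherits strict
    differentiability from \<open>F'\<close>.\<close>
  define E where "E = Blinfun (\<lambda>h::real^'n. (h, 0::real^'d))"
  have E: "blinfun_apply E h = (h, 0)" for h
    unfolding E_def by (subst bounded_linear_Blinfun_apply) (auto intro: bounded_linear_intros)
  define G where "G q = F' q o\<^sub>L E" for q
  have G_apply: "blinfun_apply (G q) h = blinfun_apply (F' q) (h, 0)" for q h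
    by (simp add: G_def E)
  have lin: "linear (blinfun_apply T)" for T :: "(real^'n) \<Rightarrow>\<^sub>L (real^'m)"
    by (simp add: blinfun.bounded_linear_right bounded_linear.linear)
  note adj_works = adjoint_works[OF lin]
  have "continuous_on U F'"
    using F' by (auto intro!: continuous_at_imp_continuous_on has_derivative_continuous)
  then have contG: "continuous_on U G"
    unfolding G_def by (intro continuous_intros)
  obtain f' where f': "has_strict_derivative f f' (x, w)"
    using assms(4) by (auto simp: strictly_differentiable_at_iff)
  have \<Phi>_strict: "has_strict_derivative \<Phi> (F' (x, w)) (x, w)"
    by (rule C1_imp_has_strict_derivative[OF U \<Phi> \<open>continuous_on U F'\<close>])
  have F'_strict: "has_strict_derivative F' (F'' (x, w)) (x, w)"
    by (rule C1_imp_has_strict_derivative[OF U F' F''])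
  have G_strict: "has_strict_derivative G (\<lambda>h. F'' (x, w) h o\<^sub>L E) (x, w)"
    unfolding G_def
    by (rule has_strict_derivative_compose[OF F'_strict has_strict_derivative_linear])
       (rule bounded_bilinear.bounded_linear_left[OF bounded_bilinear_blinfun_compose])
  have \<Phi>x: "((\<lambda>x'. \<Phi> (x', w')) has_derivative blinfun_apply (G (x', w'))) (at x')"
    if "(x', w') \<in> U" for x' w'
    using has_derivative_partial_fst[OF \<Phi>[OF that]] by (simp add: G_apply [abs_def])
  have deriv\<Phi>: "deriv_x \<Phi> x w = blinfun_apply (G (x, w))"
    unfolding deriv_x_eq[OF \<Phi>[OF U(2)]] by (simp add: G_apply [abs_def])
  have derivf: "deriv_x f x w = (\<lambda>h. f' (h, 0))"
    by (rule deriv_x_eq[OF has_strict_derivative_imp_has_derivative[OF f']])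
  have inj: "q = 0" if "q \<in> S" "adjoint (G (x, w)) q = 0" for q
    using assms(8) that by (auto simp: nondegenerate_def deriv\<Phi> S_def assms(6))
  have "isCont G (x, w)" using contG U by (simp add: continuous_on_eq_continuous_at)
  then obtain c r1 where "0 < c" "0 < r1" and
    c: "\<And>p' q. dist p' (x, w) < r1 \<Longrightarrow> q \<in> S \<Longrightarrow> c * norm q \<le> norm (adjoint (G p') q)"
    using uniform_injectivity[OF _ inj] by metis
  obtain r2 where "0 < r2" and r2: "ball (x, w) r2 \<subseteq> U" using U open_contains_ball by blast
  have "isCont \<Phi> (x, w)" using \<Phi>[OF U(2)] by (rule has_derivative_continuous)
  then obtain r3 where "0 < r3" and r3: "\<And>q. dist q (x, w) < r3 \<Longrightarrow> dist (\<Phi> q) z < \<rho>"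
    using \<rho>_pos unfolding continuous_at_eps_delta assms(6) by blast
  \<comment> \<open>The halving absorbs the factor 2 in \<open>dist_pair\<close>.\<close>
  define r where "r = min r1 (min r2 r3) / 2"
  have "0 < r" using \<open>0 < r1\<close> \<open>0 < r2\<close> \<open>0 < r3\<close> by (simp add: r_def)
  have dist_pair: "dist (a, b) (x, w) < 2 * e" if "dist a x < e" "dist b w < e" for a b e
    using norm_Pair_le[of "a - x" "b - w"] that by (simp add: dist_norm)
  have near: "(x', w') \<in> U" "dist (x', w') (x, w) < r1" "dist (\<Phi> (x', w')) z < \<rho>"
    if "dist x' x < r" "dist w' w < r" for x' w'
    using dist_pair[OF that] r2 r3[of "(x', w')"] by (auto simp: r_def dist_commute)
  have solution: "x' \<in> solution_map f \<theta> \<Phi> w' \<longleftrightarrow>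
      (\<exists>y' \<in> convex_subdifferential \<theta> (\<Phi> (x', w')). f (x', w') + adjoint (G (x', w')) y' = 0)"
    if "dist x' x < r" "dist w' w < r" for x' w'
  proof (rule mem_solution_map_iff[of "ball x r", OF open_ball _ \<Phi>x _ _ \<open>0 < c\<close>])
    show "continuous_on (ball x r) (\<lambda>x'. G (x', w'))"
      using near(1)[OF _ that(2)]
      by (intro continuous_on_compose2[OF contG]) (auto intro!: continuous_intros simp: dist_commute)
  qed (use that near c in \<open>auto simp: dist_commute\<close>)

  \<comment> \<open>The system in the unknown \<open>(x, y)\<close> and its qualification\<close>
  define \<pi> where "\<pi> q = (fst (fst q), snd q)" for q :: "((real^'n) \<times> (real^'m)) \<times> (real^'d)"
  have \<pi>: "bounded_linear \<pi>" unfolding \<pi>_def by (intro bounded_linear_intros)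
  have sf: "bounded_linear (\<lambda>q::((real^'n) \<times> (real^'m)) \<times> (real^'d). snd (fst q))"
    by (intro bounded_linear_intros)
  define H where "H q = (f (\<pi> q) + adjoint (G (\<pi> q)) (snd (fst q)), \<Phi> (\<pi> q), snd (fst q))" for q
  \<comment> \<open>Product rule at the reference point: one term varies the multiplier, the other
    differentiates the operator with \<open>y\<close> frozen.\<close>
  define H' where "H' h = (f' (\<pi> h) + (adjoint (G (x, w)) (snd (fst h)) + adjoint (F'' (x, w) (\<pi> h) o\<^sub>L E) y),
      F' (x, w) (\<pi> h), snd (fst h))" for h
  have \<pi>0: "\<pi> ((x, y), w) = (x, w)" by (simp add: \<pi>_def)
  have compose_\<pi>: "has_strict_derivative (\<lambda>q. k (\<pi> q)) (\<lambda>h. k' (\<pi> h)) ((x, y), w)"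
    if "has_strict_derivative k k' (x, w)" for k :: "_ \<Rightarrow> 'k::real_normed_vector" and k'
    by (rule has_strict_derivative_compose[OF has_strict_derivative_linear[OF \<pi>]]) (simp add: \<pi>0 that)
  have "has_strict_derivative (\<lambda>q. adjoint (G (\<pi> q)) (snd (fst q)))
      (\<lambda>h. adjoint (G (x, w)) (snd (fst h)) + adjoint (F'' (x, w) (\<pi> h) o\<^sub>L E) y) ((x, y), w)"
    using has_strict_derivative_bilinear[OF bounded_bilinear_adjoint_blinfun compose_\<pi>[OF G_strict]
        has_strict_derivative_linear[OF sf]] by (simp add: \<pi>0)
  from has_strict_derivative_Pair[OF has_strict_derivative_add[OF compose_\<pi>[OF f'] this]
      has_strict_derivative_Pair[OF compose_\<pi>[OF \<Phi>_strict] has_strict_derivative_linear[OF sf]]]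
  have H: "has_strict_derivative H H' ((x, y), w)" unfolding H_def H'_def .
  define C where "C = {0::real^'n} \<times> gph (convex_subdifferential \<theta>)"
  have "closed C" unfolding C_def by (intro closed_Times closed_graph) simp
  have H0: "H ((x, y), w) = (0, (z, y))"
    using assms(5,6,10) by (simp add: H_def \<pi>0 deriv\<Phi>)
  have qualification: "l = 0" if l: "l \<in> limiting_normal_cone (H ((x, y), w)) C"
    "adjoint (\<lambda>h. H' (h, 0)) l = 0" for l
  proof -
    obtain u q b where l_eq: "l = (u, q, b)" by (metis prod.exhaust)
    have qb: "(q, b) \<in> limiting_normal_cone (z, y) (gph (convex_subdifferential \<theta>))"
      using l(1) unfolding H0 C_def l_eq by (rule limiting_normal_cone_Times_snd)
    have "linear (\<lambda>h. H' (h, 0))"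
      using has_strict_derivative_imp_has_derivative[OF H]
      by (intro has_derivative_linear[OF has_derivative_partial_fst])
    then have zero: "H' (h, 0) \<bullet> l = 0" for h
      using adjoint_works[of "\<lambda>h. H' (h, 0)" h l] l(2) by simp
    have f'0: "f' 0 = 0" "F' (x, w) 0 = 0" "F'' (x, w) 0 = 0"
      using linear_0[OF bounded_linear.linear[OF has_strict_derivative_bounded_linear[OF f']]]
      by (simp_all add: blinfun.zero_right)
    \<comment> \<open>Varying only the multiplier determines \<open>b\<close>, which makes
      \<open>q\<close> an element of the second-order subdifferential at
      \<open>G (x, w) u\<close>.\<close>
    have "h \<bullet> (G (x, w) u + b) = 0" for h
      using zero[of "(0, h)"] adj_works[of u "G (x, w)" h]
      by (simp add: H'_def \<pi>_def l_eq f'0 adj.zero_left inner_add_right inner_commute flip: zero_prod_def)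
    then have b: "b = - G (x, w) u" using inner_eq_zero_iff by (metis add_eq_0_iff)
    define hx where "hx = hess_xx (\<lambda>p. y \<bullet> \<Phi> p) x w u"
    have hx: "hx \<bullet> h = y \<bullet> F'' (x, w) (h, 0) (u, 0)" for h
      unfolding hx_def by (rule hess_xx_inner[OF U \<Phi> F'[OF U(2)]])
    have linf: "linear (deriv_x f x w)"
      using has_derivative_linear[OF has_derivative_partial_fst[OF has_strict_derivative_imp_has_derivative[OF f']]]
      by (simp add: derivf)
    \<comment> \<open>Varying only \<open>x\<close> gives the first component of the inclusions in
      both hypotheses.\<close>
    have "h \<bullet> (adjoint (deriv_x f x w) u + hx + adjoint (G (x, w)) q) = 0" for h
    proof -
      have "adjoint (F'' (x, w) (h, 0) o\<^sub>L E) y \<bullet> u = hx \<bullet> h"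
        using adj_works[of u "F'' (x, w) (h, 0) o\<^sub>L E" y] hx[of h] by (simp add: E inner_commute)
      then show ?thesis
        using zero[of "(h, 0)"] adjoint_works[OF linf, of h u] adj_works[of h "G (x, w)" q]
        by (simp add: H'_def \<pi>_def l_eq adj.zero_right derivf G_apply inner_add_left inner_add_right inner_commute)
    qed
    then have fx: "adjoint (deriv_x f x w) u + hx + adjoint (G (x, w)) q = 0"
      using inner_eq_zero_iff by blast
    define hw where "hw = hess_xw (\<lambda>p. y \<bullet> \<Phi> p) x w u"
    \<comment> \<open>The value of the second component is taken as \<open>a\<close>, so
      \<open>u\<close> and \<open>q\<close> witness the membership whose only solution is
      zero.\<close>
    define a where "a = adjoint (deriv_w f x w) u + hw + adjoint (deriv_w \<Phi> x w) q"
    have q: "q \<in> second_order_subdifferential \<theta> z y (deriv_x \<Phi> x w u)"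
      using qb by (simp add: second_order_subdifferential_def b deriv\<Phi>)
    have mem: "(hx + adjoint (G (x, w)) q, hw + adjoint (deriv_w \<Phi> x w) q) \<in> second_order_set \<theta> \<Phi> x w y u"
      using q unfolding second_order_set_def hx_def hw_def
      by (intro image_eqI[of _ _ q]) (auto simp: adjoint_deriv_def deriv\<Phi> assms(6))
    have fx': "- adjoint (deriv_x f x w) u = hx + adjoint (G (x, w)) q"
      using fx by (simp add: add.assoc neg_eq_iff_add_eq_0)
    have "a \<in> {a. \<exists>u. deriv_x \<Phi> x w u \<in> dom_second_order_subdifferential \<theta> z y \<and>
               (- adjoint (deriv_x f x w) u, a - adjoint (deriv_w f x w) u)
                 \<in> second_order_set \<theta> \<Phi> x w y u}"
      using q mem by (intro CollectI exI[of _ u]) (auto simp: dom_second_order_subdifferential_def fx' a_def add.assoc)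
    then have "a = 0" using assms(12) by blast
    then have "0 = adjoint_deriv f x w u + (hx + adjoint (G (x, w)) q, hw + adjoint (deriv_w \<Phi> x w) q)"
      using fx by (simp add: adjoint_deriv_def a_def add.assoc zero_prod_def)
    then have "u = 0" using mem assms(11) by blast
    \<comment> \<open>With \<open>u = 0\<close> the Hessian term and the term of \<open>f\<close>
      vanish, leaving \<open>q\<close> in the kernel of the adjoint.\<close>
    then have "hx \<bullet> h = 0" for h
      unfolding hx by (simp add: blinfun.zero_right flip: zero_prod_def)
    then have "hx = 0" using inner_eq_zero_iff by blast
    moreover have "adjoint (deriv_x f x w) 0 = 0" by (rule linear_0[OF adjoint_linear[OF linf]])
    ultimately have "adjoint (G (x, w)) q = 0" using fx \<open>u = 0\<close> by simp
    moreover have "q \<in> S" by (rule normal_to_graph_in_S[OF qb])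
    ultimately have "q = 0" using inj by blast
    then show "l = 0" using \<open>u = 0\<close> b by (simp add: l_eq blinfun.zero_right zero_prod_def)
  qed

  \<comment> \<open>Return from the system to the solution map\<close>
  obtain d L where "0 < d" "0 < L" and implicit:
    "\<And>w1 w2 p1. dist w1 w < d \<Longrightarrow> dist w2 w < d \<Longrightarrow> dist p1 (x, y) < d \<Longrightarrow> H (p1, w1) \<in> C \<Longrightarrow>
       \<exists>p2. H (p2, w2) \<in> C \<and> norm (p1 - p2) \<le> L * norm (w1 - w2)"
    by (rule constraint_system_lipschitz[OF H \<open>closed C\<close>]) (use qualification in blast)+
  have "isCont f (x, w)"
    using has_strict_derivative_imp_has_derivative[OF f'] by (rule has_derivative_continuous)
  \<comment> \<open>The residual of the fixed multiplier \<open>y\<close> is small near the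
    reference point; divided by \<open>c\<close>, it will bound the distance of other multipliers
    from \<open>y\<close>.\<close>
  then have "isCont (\<lambda>q. f q + adjoint (G q) y) (x, w)"
    using \<open>isCont G (x, w)\<close> by (intro continuous_add adj.continuous continuous_const)
  moreover have "f (x, w) + adjoint (G (x, w)) y = 0"
    using assms(5,10) by (simp add: deriv\<Phi>)
  moreover have "0 < c * (d / 2)" using \<open>0 < c\<close> \<open>0 < d\<close> by simp
  ultimately obtain r4 where "0 < r4" and
    r4: "\<And>q. dist q (x, w) < r4 \<Longrightarrow> norm (f q + adjoint (G q) y) < c * (d / 2)"
    unfolding continuous_at_eps_delta by (metis dist_0_norm dist_commute)
  \<comment> \<open>\<open>x2\<close> lies within 2 \<delta> L of \<open>x1\<close>, hence within
    \<delta> + 2 \<delta> L of \<open>x\<close>, and must stay in the radius \<open>r\<close> to be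
    recognised as a solution. The bound 2 \<delta> <= d leaves d / 2 for the multiplier.\<close>
  define \<delta> where "\<delta> = min d (min r r4) / (2 * (1 + 2 * L))"
  have "0 < \<delta>" using \<open>0 < d\<close> \<open>0 < r\<close> \<open>0 < r4\<close> \<open>0 < L\<close> by (simp add: \<delta>_def)
  have "\<delta> * (2 * (1 + 2 * L)) = min d (min r r4)" using \<open>0 < L\<close> by (simp add: \<delta>_def)
  then have \<delta>: "2 * \<delta> + 4 * (\<delta> * L) \<le> d" "2 * \<delta> + 4 * (\<delta> * L) \<le> r" "2 * \<delta> + 4 * (\<delta> * L) \<le> r4"
    by (simp_all add: distrib_left)
  have "0 < \<delta> * L" using \<open>0 < \<delta>\<close> \<open>0 < L\<close> by simp
  show ?thesis
  proof (rule lipschitz_likeI[OF \<open>0 < \<delta>\<close> \<open>0 < L\<close>])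
    fix w1 w2 x1
    assume w1: "dist w1 w < \<delta>" and w2: "dist w2 w < \<delta>" and x1: "dist x1 x < \<delta>"
      and sol: "x1 \<in> solution_map f \<theta> \<Phi> w1"
    have x1r: "dist x1 x < r" "dist w1 w < r" using x1 w1 \<delta>(2) \<open>0 < \<delta> * L\<close> \<open>0 < \<delta>\<close> by linarith+
    obtain y1 where y1: "y1 \<in> convex_subdifferential \<theta> (\<Phi> (x1, w1))" "f (x1, w1) + adjoint (G (x1, w1)) y1 = 0"
      using sol solution[OF x1r] by blast
    have "y1 - y \<in> S" using subgradient_diff_in_S[OF y1(1) near(3)[OF x1r]] .
    then have "c * norm (y1 - y) \<le> norm (adjoint (G (x1, w1)) (y1 - y))"
      by (rule c[OF near(2)[OF x1r]])
    \<comment> \<open>As \<open>y1\<close> solves the equation exactly, the adjoint at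
      \<open>y1 - y\<close> is minus the residual of \<open>y\<close>; hence solutions near
      \<open>x\<close> have multipliers near \<open>y\<close>.\<close>
    also have "adjoint (G (x1, w1)) (y1 - y) = - (f (x1, w1) + adjoint (G (x1, w1)) y)"
      using y1(2) by (simp add: adj.diff_right eq_neg_iff_add_eq_0 add.commute)
    also have "norm \<dots> < c * (d / 2)"
      using r4[of "(x1, w1)"] dist_pair[OF x1 w1] \<delta>(3) \<open>0 < \<delta> * L\<close>
      unfolding norm_minus_cancel by simp
    finally have "dist y1 y < d / 2" using \<open>0 < c\<close> by (simp add: dist_norm)
    moreover have "dist (x1, y1) (x, y) \<le> dist x1 x + dist y1 y"
      using norm_Pair_le[of "x1 - x" "y1 - y"] by (simp add: dist_norm)
    ultimately have "dist (x1, y1) (x, y) < d" using x1 \<delta>(1) \<open>0 < \<delta> * L\<close> by linarith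
    moreover have "H ((x1, y1), w1) \<in> C" using y1 by (simp add: H_def \<pi>_def C_def gph_def)
    moreover have "dist w1 w < d" "dist w2 w < d" using w1 w2 \<delta>(1) \<open>0 < \<delta> * L\<close> \<open>0 < \<delta>\<close> by linarith+
    ultimately obtain x2 y2 where p2: "H ((x2, y2), w2) \<in> C"
        "norm ((x1, y1) - (x2, y2)) \<le> L * norm (w1 - w2)"
      using implicit by (metis prod.exhaust)
    have x12: "norm (x1 - x2) \<le> L * norm (w1 - w2)"
      using p2(2) norm_fst_le[of "x1 - x2" "y1 - y2"] by simp
    also have "\<dots> \<le> L * (2 * \<delta>)"
      using norm_triangle_ineq4[of "w1 - w" "w2 - w"] w1 w2 \<open>0 < L\<close>
      by (intro mult_left_mono) (auto simp: dist_norm)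
    finally have "norm (x1 - x2) \<le> 2 * (\<delta> * L)" by (simp add: mult_ac)
    moreover have "dist x2 x \<le> norm (x1 - x2) + dist x1 x"
      using dist_triangle[of x2 x x1] by (simp add: dist_norm norm_minus_commute)
    ultimately have "dist x2 x < r" "dist w2 w < r" using x1 w2 \<delta>(2) \<open>0 < \<delta> * L\<close> \<open>0 < \<delta>\<close> by linarith+
    moreover have "y2 \<in> convex_subdifferential \<theta> (\<Phi> (x2, w2))" "f (x2, w2) + adjoint (G (x2, w2)) y2 = 0"
      using p2(1) by (simp_all add: H_def \<pi>_def C_def gph_def)
    ultimately have "x2 \<in> solution_map f \<theta> \<Phi> w2" using solution by blast
    then show "\<exists>x2 \<in> solution_map f \<theta> \<Phi> w2. norm (x1 - x2) \<le> L * norm (w1 - w2)"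
      using x12 by blast
  qed
qed

end
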